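(* Let $d=2$, $\alpha\in(14/9,2)$ and $\mathbf{k}(x)=\min(1,|x|^{-\alpha})$ for $x\in\mathbb{Z}^2$. Then the killed random walk conditioned to survive is not well-defined. More precisely, there exist two exhaustions $\Lambda^1=(\Lambda^1_R)_{R\in\mathbb{N}}$ and $\Lambda^2=(\Lambda^2_R)_{R\in\mathbb{N}}$ of $\mathbb{Z}^2$ and points $x,y\in\mathbb{Z}^2$ (for which the ratios below are well defined, i.e. have positive denominators) such that $$\lim_{R\to\infty}\frac{\mathbb{P}_x[\tau((\Lambda^1_R)^c)<\tau(\Delta)]}{\mathbb{P}_y[\tau((\Lambda^1_R)^c)<\tau(\Delta)]}\neq\lim_{R\to\infty}\frac{\mathbb{P}_x[\tau((\Lambda^2_R)^c)<\tau(\Delta)]}{\mathbb{P}_y[\tau((\Lambda^2_R)^c)<\tau(\Delta)]},$$ in the sense that either at least one of these limits does not exist, or both exist and they are different.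
   Context: $|\cdot|$ is the Euclidean norm; $x\sim y$ means $|x-y|=1$; $\mathbf{k}(0)=1$ by the convention $|0|^{-\alpha}=+\infty$. An exhaustion of $\mathbb{Z}^2$ is an increasing sequence $(\Lambda_R)_{R\in\mathbb{N}}$ of finite subsets of $\mathbb{Z}^2$ such that every $x\in\mathbb{Z}^2$ belongs to $\Lambda_R$ for some $R$; $\Lambda_R^c=\mathbb{Z}^2\setminus\Lambda_R$. Killed random walk (KRW): $S^{\mathbf{k}}$ is the Markov chain on $\mathbb{Z}^2\cup\{\Delta\}$ ($\Delta$ an additional cemetery state) with transition probabilities $Q(\Delta,\Delta)=1$, $Q(x,\Delta)=\mathbf{k}(x)$ and $Q(x,y)=\frac{1-\mathbf{k}(x)}{4}\mathbf 1_{x\sim y}$ for $x,y\in\mathbb{Z}^2$. $\mathbb{P}_x$ is the law of the chain started at $x$. For $A\subset\mathbb{Z}^2\cup\{\Delta\}$, $\tau(A)=\inf\{n\ge 0: S^{\mathbf{k}}_n\in A\}$, and $\tau(\Delta)=\tau(\{\Delta\})$. $E_{\mathbf{k}}\subset\mathbb{Z}^2$ is the set of $x$ from which there is a nearest-neighbour path $x=x_0,x_1,x_2,\dots$ with $\mathbf{k}(x_i)<1$ for all $i\ge0$ and $|x_i|\to\infty$. The KRW conditioned to survive is said to be well-defined if for any exhaustion $\Lambda$ and any $x\in E_{\mathbf{k}}$, the KRW started at $x$ and conditioned on $\{\tau(\Lambda_R^c)<\tau(\Delta)\}$ converges in distribution as $R\to\infty$ (i.e. for each fixed $n$ the law of $(S_0^{\mathbf{k}},\dots,S_n^{\mathbf{k}})$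 converges) to a Markov chain on $E_{\mathbf{k}}$ which does not depend on the exhaustion. *)

theory Defs
  imports "HOL-Probability.Probability"
begin

section \<open>Path law of a Markov chain\<close>

text \<open>The law, on the product space \<^typ>\<open>nat \<Rightarrow> 'a\<close>, of the time-homogeneous Markov chain with
  transition kernel \<^term>\<open>K\<close> started at \<^term>\<open>x\<close>, obtained from the Ionescu-Tulcea theorem.  All uses
  below are for a countable state space, whence the discrete sigma-algebra.\<close>

definition mc_step :: "('a \<Rightarrow> 'a pmf) \<Rightarrow> 'a \<Rightarrow> nat \<Rightarrow> (nat \<Rightarrow> 'a) \<Rightarrow> 'a measure" where
  "mc_step K x n \<omega> = measure_pmf (case n of 0 \<Rightarrow> return_pmf x | Suc m \<Rightarrow> K (\<omega> m))"

lemma Ionescu_Tulcea_mc_step: "Ionescu_Tulcea (mc_step K x) (\<lambda>_. count_space UNIV)"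
proof (rule Ionescu_Tulcea.intro)
  fix i :: nat
  show "mc_step K x i \<in> measurable (PiM {0..<i} (\<lambda>_. count_space UNIV)) (subprob_algebra (count_space UNIV))"
  proof (cases i)
    case 0
    then show ?thesis
      unfolding mc_step_def
      by (auto intro!: measurable_const simp: space_subprob_algebra subprob_space_measure_pmf)
  next
    case (Suc m)
    have "(\<lambda>\<omega>. measure_pmf (K (\<omega> m))) \<in> measurable (PiM {0..<i} (\<lambda>_. count_space UNIV)) (subprob_algebra (count_space UNIV))"
      by (rule measurable_compose[where f = "\<lambda>\<omega>. \<omega> m" and N = "count_space UNIV"])
         (auto simp: Suc space_subprob_algebra subprob_space_measure_pmf
               intro!: measurable_component_singleton)
    then show ?thesis
      using Suc by (simp add: mc_step_def[abs_def])
  qed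
next
  show "prob_space (mc_step K x i \<omega>)" for i \<omega>
    unfolding mc_step_def by (rule prob_space_measure_pmf)
qed

definition mc_law :: "('a \<Rightarrow> 'a pmf) \<Rightarrow> 'a \<Rightarrow> (nat \<Rightarrow> 'a) measure" where
  "mc_law K x = projective_family.lim UNIV
     (Ionescu_Tulcea.CI (mc_step K x) (\<lambda>_. count_space UNIV)) (\<lambda>_. count_space UNIV)"

lemma sets_mc_law [simp, measurable_cong]:
    "sets (mc_law K x) = sets (PiM UNIV (\<lambda>_. count_space UNIV))"
  and space_mc_law [simp]: "space (mc_law K x) = UNIV"
proof -
  interpret Ionescu_Tulcea "mc_step K x" "\<lambda>_. count_space UNIV"
    by (rule Ionescu_Tulcea_mc_step)
  show "sets (mc_law K x) = sets (PiM UNIV (\<lambda>_. count_space UNIV))" "space (mc_law K x) = UNIV"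
    by (simp_all add: mc_law_def space_PiM)
qed

lemma emeasure_mc_law_cylinder:
  "emeasure (mc_law K x) {\<omega>. \<forall>i\<le>n. \<omega> i = w i} =
     ennreal ((if w 0 = x then 1 else 0) * (\<Prod>i<n. pmf (K (w i)) (w (Suc i))))"
proof -
  let ?M = "\<lambda>_::nat. count_space (UNIV :: 'a set)"
  interpret Ionescu_Tulcea "mc_step K x" ?M
    by (rule Ionescu_Tulcea_mc_step)
  let ?A = "\<lambda>n. PiE {0..<n} (\<lambda>i. {w i})"
  have A [measurable]: "?A n \<in> sets (PiM {0..<n} ?M)" for n
    by (intro sets_PiM_I_finite) auto
  have C: "emeasure (C 0 (Suc n) (\<lambda>_. undefined)) (?A (Suc n)) =
     ennreal ((if w 0 = x then 1 else 0) * (\<Prod>i<n. pmf (K (w i)) (w (Suc i))))" for n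
  proof -
    have und: "(\<lambda>_. undefined) \<in> space (PiM {0..<0} ?M)"
      by (simp add: space_PiM)
    have step: "emeasure (C 0 (Suc n) (\<lambda>_. undefined)) (?A (Suc n)) =
        emeasure (C 0 n (\<lambda>_. undefined)) (?A n) * emeasure (mc_step K x n w) {w n}" for n
    proof -
      have eP_A: "emeasure (eP n \<omega>) (?A (Suc n)) = emeasure (mc_step K x n w) {w n} * indicator (?A n) \<omega>"
        if \<omega>: "\<omega> \<in> space (PiM {0..<n} ?M)" for \<omega>
      proof -
        have "(\<lambda>y. fun_upd \<omega> n y) -` ?A (Suc n) = (if \<omega> \<in> ?A n then {w n} else {})"
          using \<omega> by (auto simp: space_PiM PiE_iff extensional_def less_Suc_eq split: if_splits)
        moreover have "mc_step K x n \<omega> = mc_step K x n w" if "\<omega> \<in> ?A n"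
          using that by (auto simp: mc_step_def PiE_iff split: nat.splits)
        ultimately show ?thesis
          by (subst emeasure_eP[OF \<omega>]) auto
      qed
      have "emeasure (C 0 (Suc n) (\<lambda>_. undefined)) (?A (Suc n)) =
          (\<integral>\<^sup>+\<omega>. emeasure (eP n \<omega>) (?A (Suc n)) \<partial>C 0 n (\<lambda>_. undefined))"
        using measurable_eP[of n]
        by (simp, subst emeasure_bind[where N = "PiM {0..<Suc n} ?M"])
           (auto simp: space_C[OF und] measurable_cong_sets[OF sets_C[OF und] refl])
      also have "\<dots> = (\<integral>\<^sup>+\<omega>. emeasure (mc_step K x n w) {w n} * indicator (?A n) \<omega> \<partial>C 0 n (\<lambda>_. undefined))"
        by (intro nn_integral_cong eP_A) (simp add: space_C[OF und])
      also have "\<dots> = emeasure (mc_step K x n w) {w n} * emeasure (C 0 n (\<lambda>_. undefined)) (?A n)"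
        using A[of n] by (intro nn_integral_cmult_indicator) (simp add: sets_C[OF und])
      finally show ?thesis
        by (simp add: mult.commute)
    qed
    show ?thesis
    proof (induction n)
      case 0
      show ?case
        by (subst step) (auto simp: mc_step_def emeasure_pmf_single PiM_empty emeasure_return)
    next
      case (Suc n)
      show ?case
        by (subst step, subst Suc)
           (simp add: mc_step_def emeasure_pmf_single ennreal_mult'[symmetric] prod_nonneg mult.assoc)
    qed
  qed
  have "{\<omega>. \<forall>i\<le>n. \<omega> i = w i} = PF.emb UNIV {0..<Suc n} (?A (Suc n))"
    by (auto simp: prod_emb_iff PiE_iff less_Suc_eq_le)
  then have "emeasure (mc_law K x) {\<omega>. \<forall>i\<le>n. \<omega> i = w i} = emeasure (CI {0..<Suc n}) (?A (Suc n))"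
    by (simp add: mc_law_def lim)
  also have "\<dots> = emeasure (C 0 (Suc n) (\<lambda>_. undefined)) (?A (Suc n))"
    by (subst emeasure_CI[of _ "Suc n"]) (auto simp del: C.simps simp: prod_emb_id sets.sets_into_space[OF A])
  finally show ?thesis
    by (simp only: C)
qed

lemma prob_space_mc_law: "prob_space (mc_law K x)"
proof
  interpret Ionescu_Tulcea "mc_step K x" "\<lambda>_. count_space UNIV"
    by (rule Ionescu_Tulcea_mc_step)
  have "emeasure (mc_law K x) (PF.emb UNIV {} {\<lambda>_. undefined}) = emeasure (CI {}) {\<lambda>_. undefined}"
    unfolding mc_law_def by (rule lim) (auto simp: PiM_empty)
  moreover have "PF.emb UNIV {} {\<lambda>_. undefined} = UNIV"
    by (auto simp: prod_emb_iff restrict_def)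
  moreover have "emeasure (CI {}) (space (CI {})) = 1"
    by (intro prob_space.emeasure_space_1 PF.prob_space_P) auto
  ultimately show "emeasure (mc_law K x) (space (mc_law K x)) = 1"
    by (simp add: PF.space_P space_PiM)
qed

text \<open>The hitting time, \<^term>\<open>\<infinity>\<close> if the set is never hit.\<close>

definition hit :: "'a set \<Rightarrow> (nat \<Rightarrow> 'a) \<Rightarrow> enat" where
  "hit A \<omega> = Inf {enat n | n. \<omega> n \<in> A}"

lemma hit_less_iff: "hit A \<omega> < hit B \<omega> \<longleftrightarrow> (\<exists>n. \<omega> n \<in> A \<and> (\<forall>m\<le>n. \<omega> m \<notin> B))"
proof
  assume l: "hit A \<omega> < hit B \<omega>"
  then obtain n where n: "\<omega> n \<in> A" "enat n < hit B \<omega>"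
    unfolding hit_def[of A] by (auto simp: Inf_less_iff)
  have "\<omega> m \<notin> B" if "m \<le> n" for m
  proof
    assume "\<omega> m \<in> B"
    then have "hit B \<omega> \<le> enat m"
      unfolding hit_def by (intro Inf_lower) auto
    with n(2) that show False
      by (metis enat_ord_simps(1) leD order.trans)
  qed
  with n show "\<exists>n. \<omega> n \<in> A \<and> (\<forall>m\<le>n. \<omega> m \<notin> B)"
    by blast
next
  assume "\<exists>n. \<omega> n \<in> A \<and> (\<forall>m\<le>n. \<omega> m \<notin> B)"
  then obtain n where n: "\<omega> n \<in> A" "\<And>m. m \<le> n \<Longrightarrow> \<omega> m \<notin> B"
    by blast
  have "hit A \<omega> \<le> enat n"
    unfolding hit_def using n by (intro Inf_lower) auto
  also have "enat n < enat (Suc n)"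
    by simp
  also have "enat (Suc n) \<le> hit B \<omega>"
    unfolding hit_def using n by (intro Inf_greatest) (auto simp: not_less_eq_eq[symmetric])
  finally show "hit A \<omega> < hit B \<omega>" .
qed

lemma sets_hit_less [measurable]:
  "{\<omega>. hit A \<omega> < hit B \<omega>} \<in> sets (PiM UNIV (\<lambda>_. count_space UNIV))"
proof -
  have [measurable]: "Measurable.pred (PiM UNIV (\<lambda>_. count_space UNIV)) (\<lambda>\<omega>. \<omega> n \<in> S)"
    for n :: nat and S :: "'a set"
    by (rule measurable_compose[where f = "\<lambda>\<omega>. \<omega> n" and N = "count_space UNIV"])
       (auto intro!: measurable_component_singleton)
  have "{\<omega> \<in> space (PiM UNIV (\<lambda>_. count_space UNIV)). \<exists>n. \<omega> n \<in> A \<and> (\<forall>m\<le>n. \<omega> m \<notin> B)}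
      \<in> sets (PiM UNIV (\<lambda>_::nat. count_space (UNIV :: 'a set)))"
    by measurable
  then show ?thesis
    by (simp add: hit_less_iff space_PiM)
qed

text \<open>Convergence in distribution of finite-dimensional marginals: every function on the discrete
  space of finite paths is continuous, so the test functions are all bounded ones.\<close>

definition converges_in_distribution :: "(nat \<Rightarrow> (nat \<Rightarrow> 'a) measure) \<Rightarrow> (nat \<Rightarrow> 'a) measure \<Rightarrow> bool" where
  "converges_in_distribution \<mu> \<nu> \<longleftrightarrow>
     (\<forall>n. \<forall>f :: 'a list \<Rightarrow> real. bounded (range f) \<longrightarrow>
        (\<lambda>R. \<integral>\<omega>. f (map \<omega> [0..<Suc n]) \<partial>\<mu> R) \<longlonglongrightarrow> (\<integral>\<omega>. f (map \<omega> [0..<Suc n]) \<partial>\<nu>))"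


section \<open>The killed random walk on the square lattice\<close>

type_synonym site = "int \<times> int"

definition znorm :: "site \<Rightarrow> real" where
  "znorm x = norm (real_of_int (fst x), real_of_int (snd x))"

definition adj :: "site \<Rightarrow> site \<Rightarrow> bool" where
  "adj x y \<longleftrightarrow> znorm (x - y) = 1"

lemma znorm_eq: "znorm x = sqrt (real_of_int ((fst x)\<^sup>2 + (snd x)\<^sup>2))"
  by (simp add: znorm_def norm_Pair)

lemma neighbours_eq: "{y. adj x y} = (\<lambda>e. x + e) ` {(1,0), (-1,0), (0,1), (0,-1)}"
proof -
  have sq: "a\<^sup>2 + b\<^sup>2 = 1 \<longleftrightarrow> (a, b) \<in> {(1,0), (-1,0), (0,1), (0,-1)}" for a b :: int
  proof
    assume h: "a\<^sup>2 + b\<^sup>2 = 1"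
    then have "a\<^sup>2 \<le> 1\<^sup>2" "b\<^sup>2 \<le> 1\<^sup>2"
      using zero_le_power2[of a] zero_le_power2[of b] by (simp_all del: zero_le_power2, linarith+)
    then have "\<bar>a\<bar> \<le> 1" "\<bar>b\<bar> \<le> 1"
      by (simp_all add: abs_square_le_1)
    then have "a \<in> {-1, 0, 1}" "b \<in> {-1, 0, 1}"
      by auto
    with h show "(a, b) \<in> {(1,0), (-1,0), (0,1), (0,-1)}"
      by auto
  qed auto
  have "adj x y \<longleftrightarrow> (fst y - fst x)\<^sup>2 + (snd y - snd x)\<^sup>2 = 1" for y
    unfolding adj_def znorm_eq
    by (simp only: real_sqrt_eq_1_iff of_int_eq_1_iff fst_diff snd_diff power2_commute)
  then have "adj x y \<longleftrightarrow> y - x \<in> {(1,0), (-1,0), (0,1), (0,-1)}" for y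
    by (simp only: sq) (simp add: prod_eq_iff)
  then show ?thesis
    by (force simp: image_iff algebra_simps)
qed

lemma finite_neighbours: "finite {y. adj x y}"
  and card_neighbours: "card {y. adj x y} = 4"
proof -
  show "finite {y. adj x y}"
    by (simp add: neighbours_eq)
  show "card {y. adj x y} = 4"
    by (simp add: neighbours_eq plus_prod_def)
qed

text \<open>The cemetery state is \<^term>\<open>None\<close>.\<close>

fun krw_trans :: "(site \<Rightarrow> real) \<Rightarrow> site option \<Rightarrow> site option \<Rightarrow> real" where
  "krw_trans k None None = 1"
| "krw_trans k None (Some y) = 0"
| "krw_trans k (Some x) None = k x"
| "krw_trans k (Some x) (Some y) = (1 - k x) / 4 * (if adj x y then 1 else 0)"

text \<open>\<^const>\<open>embed_pmf\<close> is meaningful because the transition probabilities sum to 1; this is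
  \<open>pmf_krw_kernel\<close> below, for killing functions with values in $[0,1]$.\<close>

definition krw_kernel :: "(site \<Rightarrow> real) \<Rightarrow> site option \<Rightarrow> site option pmf" where
  "krw_kernel k s = embed_pmf (krw_trans k s)"

lemma pmf_krw_kernel:
  assumes "\<And>x. 0 \<le> k x" "\<And>x. k x \<le> 1"
  shows "pmf (krw_kernel k s) t = krw_trans k s t"
  unfolding krw_kernel_def
proof (rule pmf_embed_pmf)
  show nonneg: "0 \<le> krw_trans k s u" for u
    using assms by (cases "(k, s, u)" rule: krw_trans.cases) auto
  show "(\<integral>\<^sup>+u. ennreal (krw_trans k s u) \<partial>count_space UNIV) = 1"
  proof (cases s)
    case None
    have "(\<integral>\<^sup>+u. ennreal (krw_trans k s u) \<partial>count_space UNIV) = (\<Sum>u\<in>{None}. ennreal (krw_trans k s u))"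
      by (rule nn_integral_count_space'[where A = "{None}"])
         (auto simp: None elim!: option.exhaust)
    then show ?thesis
      by (simp add: None)
  next
    case (Some x)
    let ?A = "insert None (Some ` {y. adj x y})"
    have "krw_trans k s u = 0" if "u \<notin> ?A" for u
      using that by (cases u) (auto simp: Some)
    then have "(\<integral>\<^sup>+u. ennreal (krw_trans k s u) \<partial>count_space UNIV) = (\<Sum>u\<in>?A. ennreal (krw_trans k s u))"
      by (intro nn_integral_count_space') (auto simp: finite_neighbours)
    also have "\<dots> = ennreal (\<Sum>u\<in>?A. krw_trans k s u)"
      using nonneg by simp
    also have "(\<Sum>u\<in>?A. krw_trans k s u) = 1"
      by (simp add: finite_neighbours sum.reindex Some card_neighbours field_simps)
    finally show ?thesis
      by simp
  qed
qed

definition krw_law :: "(site \<Rightarrow> real) \<Rightarrow> site \<Rightarrow> (nat \<Rightarrow> site option) measure" where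
  "krw_law k x = mc_law (krw_kernel k) (Some x)"

definition exhaustion :: "(nat \<Rightarrow> site set) \<Rightarrow> bool" where
  "exhaustion \<Lambda> \<longleftrightarrow> incseq \<Lambda> \<and> (\<forall>R. finite (\<Lambda> R)) \<and> (\<forall>x. \<exists>R. x \<in> \<Lambda> R)"

text \<open>The event that the walk leaves \<open>L\<close> before being killed; the complement of \<open>L\<close> is taken
  within the lattice, so it does not contain the cemetery state.\<close>

definition exit_before_killing :: "site set \<Rightarrow> (nat \<Rightarrow> site option) set" where
  "exit_before_killing L = {\<omega>. hit (Some ` (- L)) \<omega> < hit {None} \<omega>}"

definition exit_prob :: "(site \<Rightarrow> real) \<Rightarrow> site set \<Rightarrow> site \<Rightarrow> real" where
  "exit_prob k L x = measure (krw_law k x) (exit_before_killing L)"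

definition escape_set :: "(site \<Rightarrow> real) \<Rightarrow> site set" where
  "escape_set k = {x. \<exists>p :: nat \<Rightarrow> site. p 0 = x \<and> (\<forall>i. adj (p i) (p (Suc i))) \<and>
      (\<forall>i. k (p i) < 1) \<and> filterlim (\<lambda>i. znorm (p i)) at_top sequentially}"

text \<open>\<^const>\<open>uniform_measure\<close> is the library's conditional measure
  ($\mu(\cdot\cap A)/\mu(A)$).  A Markov chain on \<open>escape_set k\<close> is given by a kernel under
  which that set is closed.\<close>

definition conditioned_krw_well_defined :: "(site \<Rightarrow> real) \<Rightarrow> bool" where
  "conditioned_krw_well_defined k \<longleftrightarrow>
     (\<forall>x \<in> escape_set k. \<exists>K :: site option \<Rightarrow> site option pmf.
        (\<forall>z \<in> Some ` escape_set k. set_pmf (K z) \<subseteq> Some ` escape_set k) \<and>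
        (\<forall>\<Lambda>. exhaustion \<Lambda> \<longrightarrow>
           converges_in_distribution
             (\<lambda>R. uniform_measure (krw_law k x) (exit_before_killing (\<Lambda> R)))
             (mc_law K (Some x))))"

text \<open>The value at the origin is given separately, since \<^term>\<open>0 powr a = 0\<close> in HOL.\<close>

definition kill :: "real \<Rightarrow> site \<Rightarrow> real" where
  "kill \<alpha> x = (if x = (0, 0) then 1 else min 1 (znorm x powr (- \<alpha>)))"

lemma kill_range: "0 \<le> kill \<alpha> x" "kill \<alpha> x \<le> 1"
  by (auto simp: kill_def)

end

(* With p = 1/2 - alpha/4 and s = |z|^2, the function exp(s^p/p) s^(-p/2) and its product with
   x/|z|, where z = (x,y), are both harmonic for the killed walk up to a relative error O(1/s): the
   two growing solutions have the same size, one of them seeing the direction of z.  The function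
   exp(s^p/p) s^(-p) has a relative gain of order s^(p-1), which absorbs this error, so there are
   exact sub- and supersolutions with these leading terms.  For discs, the exit probabilities from
   (a,0) and (-a,0) agree by symmetry.  From the union of the disc of radius sqrt R and the left half
   of the disc of radius R the surviving walk exits mainly on the right, and the barriers show that
   for large a the exit probability from (a,0) is at least twice the one from (-a,0).  If the
   conditioned walk were well defined, its one-step transition probabilities would give limits,
   independent of the exhaustion, of the ratios of exit probabilities at adjacent sites, hence, along
   a path, of the ratio at (a,0) and (-a,0). *)
theory Submission
  imports Defs
begin

section \<open>One step of the chain\<close>

text \<open>For a smooth function f of s, one unkilled step changes f on average by about s f'' +
  f', so a radial profile has to solve s f'' + f' = s^(2p-1) f, where 2p - 1 = -\<alpha>/2. For f =
  exp(s^p/p) s^(-c) the left side is (s^(2p-1) + (p - 2c) s^(p-1) + O(1/s)) f. This forces c = p/2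
  for an approximate solution and leaves the term -p s^(p-1) when c = p. A factor x contributes a
  further s^(p-1), hence c = p/2 + 1/2 in that case. The angular dependence thus costs only a
  relative error O(1/s). As p > 0, this is smaller than p s^(p-1) s^(-p/2), what the correction
  gains relative to the main profile, and so the direction still matters at infinity. The bound p
  \<le> 1/6 serves the Taylor expansion: s changes by at most 3 sqrt s in a step, so the cubic term
  of the exponential is of order s^(3p) s^(-3/2), which is then O(1/s). The expansion fails near the
  origin; there a constant is added to the supersolutions, which gains at every site because of the
  killing.\<close>

lemma path_cylinders_generate:
  "sets (PiM UNIV (\<lambda>_::nat. count_space (UNIV :: 'a::countable set))) =
     sigma_sets UNIV (insert {} {{\<omega>. \<forall>i\<le>n. \<omega> i = w i} | n w. True})" (is "_ = sigma_sets UNIV ?E")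
proof
  have gen: "sets (PiM UNIV (\<lambda>_::nat. count_space (UNIV :: 'a set))) =
      sigma_sets UNIV {{\<omega>. \<omega> i \<in> A} | i A. True}"
    by (subst sets_PiM_single) (auto simp: PiE_UNIV_domain intro!: arg_cong2[where f = sigma_sets])
  interpret S: sigma_algebra "UNIV :: (nat \<Rightarrow> 'a) set" "sigma_sets UNIV ?E"
    by (rule sigma_algebra_sigma_sets) auto
  show "sets (PiM UNIV (\<lambda>_::nat. count_space (UNIV :: 'a set))) \<subseteq> sigma_sets UNIV ?E"
    unfolding gen
  proof (rule S.sigma_sets_subset, safe)
    fix i :: nat and A :: "'a set"
    \<comment> \<open>Initial segments are indexed by lists and not by functions \<open>w\<close>:
      lists over a countable type are countable, so this union is a countable one.\<close>
    have "{\<omega>. \<omega> i \<in> A} = (\<Union>xs\<in>{xs. length xs = Suc i \<and> xs ! i \<in> A}. {\<omega>. \<forall>j\<le>i. \<omega> j = xs ! j})"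
    proof safe
      fix \<omega> :: "nat \<Rightarrow> 'a" assume "\<omega> i \<in> A"
      then show "\<omega> \<in> (\<Union>xs\<in>{xs. length xs = Suc i \<and> xs ! i \<in> A}. {\<omega>. \<forall>j\<le>i. \<omega> j = xs ! j})"
        by (intro UN_I[of "map \<omega> [0..<Suc i]"]) (auto simp del: upt_Suc)
    qed auto
    also have "\<dots> \<in> sigma_sets UNIV ?E"
      by (intro S.countable_UN' sigma_sets.Basic) blast+
    finally show "{\<omega>. \<omega> i \<in> A} \<in> sigma_sets UNIV ?E" .
  qed
  show "sigma_sets UNIV ?E \<subseteq> sets (PiM UNIV (\<lambda>_::nat. count_space (UNIV :: 'a set)))"
  proof -
    have "{\<omega>. \<forall>i\<le>n. \<omega> i = w i} \<in> sets (PiM UNIV (\<lambda>_::nat. count_space (UNIV :: 'a set)))" for n w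
    proof -
      have "{\<omega> \<in> space (PiM UNIV (\<lambda>_::nat. count_space (UNIV :: 'a set))). \<forall>i\<in>{..n}. \<omega> i = w i}
        \<in> sets (PiM UNIV (\<lambda>_::nat. count_space (UNIV :: 'a set)))"
        by measurable
      then show ?thesis by (simp add: space_PiM Ball_def)
    qed
    then show ?thesis
      using sets.sigma_sets_subset[of ?E "PiM UNIV (\<lambda>_::nat. count_space (UNIV :: 'a set))"]
      by (auto simp: space_PiM)
  qed
qed

text \<open>Two cylinders are nested or disjoint, so together with the empty set they form an
  intersection-stable generator; those fixing only the state at time 0 give a countable
  cover.\<close>

lemma path_measure_eqI:
  fixes M N :: "(nat \<Rightarrow> 'a::countable) measure"
  assumes sets: "sets M = sets (PiM UNIV (\<lambda>_. count_space UNIV))"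
      "sets N = sets (PiM UNIV (\<lambda>_. count_space UNIV))"
    and fin: "finite_measure M"
    and eq: "\<And>n w. emeasure M {\<omega>. \<forall>i\<le>n. \<omega> i = w i} = emeasure N {\<omega>. \<forall>i\<le>n. \<omega> i = w i}"
  shows "M = N"
proof (rule measure_eqI_generator_eq[where \<Omega> = UNIV
      and E = "insert {} {{\<omega>. \<forall>i\<le>n. \<omega> i = w i} | n w. True}"
      and A = "\<lambda>j. {\<omega>. \<forall>i\<le>0. \<omega> i = from_nat j}"])
  let ?E = "insert {} {{\<omega>. \<forall>i\<le>n. \<omega> i = w i} | n w. True} :: (nat \<Rightarrow> 'a) set set"
  have int: "{\<omega>. \<forall>i\<le>n. \<omega> i = w i} \<inter> {\<omega>. \<forall>i\<le>m. \<omega> i = v i} \<in> ?E" if "n \<le> m" for n m :: nat and w v :: "nat \<Rightarrow> 'a"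
  proof (cases "\<forall>i\<le>n. w i = v i")
    case True
    then have "{\<omega>. \<forall>i\<le>n. \<omega> i = w i} \<inter> {\<omega>. \<forall>i\<le>m. \<omega> i = v i} = {\<omega>. \<forall>i\<le>m. \<omega> i = v i}"
      using that by auto
    then show ?thesis by blast
  next
    case False
    then obtain i where "i \<le> n" "w i \<noteq> v i" by blast
    then have "{\<omega>. \<forall>i\<le>n. \<omega> i = w i} \<inter> {\<omega>. \<forall>i\<le>m. \<omega> i = v i} = {}"
      using that by (auto dest: spec[of _ i])
    then show ?thesis by blast
  qed
  show "Int_stable ?E"
  proof (rule Int_stableI)
    fix a b assume "a \<in> ?E" "b \<in> ?E"
    then consider "a = {} \<or> b = {}"
      | n w m v where "a = {\<omega>. \<forall>i\<le>n. \<omega> i = w i}" "b = {\<omega>. \<forall>i\<le>m. \<omega> i = v i}"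
      by blast
    then show "a \<inter> b \<in> ?E"
    proof cases
      case 1 then show ?thesis by auto
    next
      case 2
      then show ?thesis using int[of n m w v] int[of m n v w] by (metis Int_commute linear)
    qed
  qed
  show "emeasure M X = emeasure N X" if "X \<in> ?E" for X
    using that eq by auto
  show "sets M = sigma_sets UNIV ?E" "sets N = sigma_sets UNIV ?E"
    using sets path_cylinders_generate by simp_all
  show "range (\<lambda>j. {\<omega>. \<forall>i\<le>0. \<omega> i = from_nat j}) \<subseteq> ?E"
    by (rule image_subsetI, rule insertI2, rule CollectI, rule exI[of _ 0], rule exI, rule conjI, rule refl, rule TrueI)
  show "(\<Union>j. {\<omega> :: nat \<Rightarrow> 'a. \<forall>i\<le>0. \<omega> i = from_nat j}) = UNIV"
    by auto (metis from_nat_to_nat)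
  show "emeasure M {\<omega>. \<forall>i\<le>0. \<omega> i = from_nat j} \<noteq> \<infinity>" for j
    using finite_measure.emeasure_finite[OF fin] by simp
qed auto

lemma mc_law_cylinder_sets:
  fixes K :: "'a::countable \<Rightarrow> 'a pmf"
  shows "{\<omega>. \<forall>i\<le>n. \<omega> i = w i} \<in> sets (mc_law K x)"
  unfolding sets_mc_law path_cylinders_generate by (rule sigma_sets.Basic) blast

lemma AE_mc_law_start:
  fixes K :: "'a::countable \<Rightarrow> 'a pmf"
  shows "AE \<omega> in mc_law K x. \<omega> 0 = x"
proof -
  interpret prob_space "mc_law K x" by (rule prob_space_mc_law)
  have "prob {\<omega>. \<forall>i\<le>0. \<omega> i = (\<lambda>_. x) i} = 1"
    using emeasure_mc_law_cylinder[of K x 0 "\<lambda>_. x"] by (simp add: measure_def)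
  then have "AE \<omega> in mc_law K x. \<omega> \<in> {\<omega>. \<forall>i\<le>0. \<omega> i = (\<lambda>_. x) i}"
    by (subst AE_in_set_eq_1) (rule mc_law_cylinder_sets)
  then show ?thesis by simp
qed

lemma measurable_path_shift:
  "(\<lambda>\<omega> i. \<omega> (Suc i)) \<in> measurable (PiM UNIV (\<lambda>_. count_space UNIV)) (PiM UNIV (\<lambda>_. count_space UNIV))"
  by (rule measurable_PiM_single') (auto simp: space_PiM)

text \<open>The Markov property at time one. Both sides are finite measures in \<open>E\<close>, so
  it is enough to compare them on cylinders.\<close>

lemma mc_law_first_step:
  fixes K :: "'a::countable \<Rightarrow> 'a pmf"
  assumes E: "E \<in> sets (PiM UNIV (\<lambda>_. count_space UNIV))"
  shows "measure (mc_law K x) {\<omega>. \<omega> (Suc 0) = y \<and> (\<lambda>i. \<omega> (Suc i)) \<in> E} =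
    pmf (K x) y * measure (mc_law K y) E"
proof -
  let ?P = "PiM UNIV (\<lambda>_::nat. count_space (UNIV :: 'a set))"
  interpret X: prob_space "mc_law K x" by (rule prob_space_mc_law)
  interpret Y: prob_space "mc_law K y" by (rule prob_space_mc_law)
  have Y1: "{\<omega>. \<omega> (Suc 0) = y} \<in> sets ?P"
  proof -
    have "{\<omega> \<in> space ?P. \<omega> (Suc 0) = y} \<in> sets ?P" by measurable
    then show ?thesis by (simp add: space_PiM)
  qed
  define f where "f = (\<lambda>\<omega> :: nat \<Rightarrow> 'a. \<lambda>i. \<omega> (Suc i))"
  have f: "f \<in> measurable ?P ?P" unfolding f_def by (rule measurable_path_shift)
  \<comment> \<open>The left side as a measure in \<open>E\<close>: restrict to the paths that are
    at \<open>y\<close> at time 1, then push forward by the shift.\<close>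
  let ?M = "distr (density (mc_law K x) (indicator {\<omega>. \<omega> (Suc 0) = y})) ?P f"
  let ?N = "scale_measure (pmf (K x) y) (mc_law K y)"
  have M: "emeasure ?M A = emeasure (mc_law K x) {\<omega>. \<omega> (Suc 0) = y \<and> f \<omega> \<in> A}" if "A \<in> sets ?P" for A
  proof -
    have fA: "f -` A \<in> sets ?P" using measurable_sets[OF f that] by (simp add: space_PiM)
    have "emeasure ?M A = emeasure (density (mc_law K x) (indicator {\<omega>. \<omega> (Suc 0) = y})) (f -` A)"
      using that f by (subst emeasure_distr) auto
    also have "\<dots> = emeasure (mc_law K x) ({\<omega>. \<omega> (Suc 0) = y} \<inter> f -` A)"
      using Y1 fA by (subst emeasure_density) (auto simp: indicator_inter_arith[symmetric] )
    also have "{\<omega>. \<omega> (Suc 0) = y} \<inter> f -` A = {\<omega>. \<omega> (Suc 0) = y \<and> f \<omega> \<in> A}" by auto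
    finally show ?thesis .
  qed
  have "?M = ?N"
  proof (rule path_measure_eqI)
    show "finite_measure ?M"
    proof (rule finite_measureI)
      show "emeasure ?M (space ?M) \<noteq> \<infinity>"
        using M[of UNIV] sets.top[of ?P]
        by (simp add: space_PiM)
    qed
  next
    fix n :: nat and w :: "nat \<Rightarrow> 'a"
    let ?C = "{\<omega>. \<forall>i\<le>n. \<omega> i = w i}"
    have C: "?C \<in> sets ?P" using mc_law_cylinder_sets[of n w K x] by simp
    have "emeasure ?M ?C = emeasure (mc_law K x) {\<omega>. \<omega> (Suc 0) = y \<and> f \<omega> \<in> ?C}" by (rule M[OF C])
    \<comment> \<open>Adding the almost sure start at \<open>x\<close> to the event makes it a
      cylinder again, that of \<open>x\<close> followed by \<open>w\<close>.\<close>
    also have "\<dots> = emeasure (mc_law K x) {\<omega>. \<omega> 0 = x \<and> \<omega> (Suc 0) = y \<and> (\<forall>i\<le>n. \<omega> (Suc i) = w i)}"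
      using AE_mc_law_start[where K = K and x = x]
    proof (intro emeasure_eq_AE)
      have m: "Measurable.pred ?P (\<lambda>\<omega>. \<omega> i = z)" for i and z :: 'a
        by measurable
      have "{\<omega> \<in> space ?P. \<omega> (Suc 0) = y \<and> (\<forall>i\<in>{..n}. \<omega> (Suc i) = w i)} \<in> sets ?P"
        "{\<omega> \<in> space ?P. \<omega> 0 = x \<and> \<omega> (Suc 0) = y \<and> (\<forall>i\<in>{..n}. \<omega> (Suc i) = w i)} \<in> sets ?P"
        using m by measurable
      then show "{\<omega>. \<omega> (Suc 0) = y \<and> f \<omega> \<in> ?C} \<in> sets (mc_law K x)"
        "{\<omega>. \<omega> 0 = x \<and> \<omega> (Suc 0) = y \<and> (\<forall>i\<le>n. \<omega> (Suc i) = w i)} \<in> sets (mc_law K x)"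
        by (simp_all add: space_PiM f_def Ball_def)
    qed (auto simp: f_def elim!: eventually_mono)
    also have "{\<omega>. \<omega> 0 = x \<and> \<omega> (Suc 0) = y \<and> (\<forall>i\<le>n. \<omega> (Suc i) = w i)} =
        (if w 0 = y then {\<omega>. \<forall>i\<le>Suc n. \<omega> i = case_nat x w i} else {})"
    proof -
      have "(\<forall>i\<le>Suc n. \<omega> i = case_nat x w i) \<longleftrightarrow> \<omega> 0 = x \<and> (\<forall>i\<le>n. \<omega> (Suc i) = w i)" for \<omega>
        by (metis Suc_le_mono not0_implies_Suc old.nat.simps(4,5) zero_le)
      then show ?thesis by auto
    qed
    also have "emeasure (mc_law K x) \<dots> = emeasure ?N ?C"
    proof (cases "w 0 = y")
      case True
      then show ?thesis
        using C by (simp add: emeasure_mc_law_cylinder prod.lessThan_Suc_shift ennreal_mult prod_nonneg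
            del: prod.lessThan_Suc)
    next
      case False
      then show ?thesis using C by (simp add: emeasure_mc_law_cylinder)
    qed
    finally show "emeasure ?M ?C = emeasure ?N ?C" .
  qed (simp_all)
  then have "emeasure (mc_law K x) {\<omega>. \<omega> (Suc 0) = y \<and> f \<omega> \<in> E} = pmf (K x) y * emeasure (mc_law K y) E"
    using M[OF E] E by (simp )
  then show ?thesis
    unfolding f_def by (simp add: measure_def enn2real_mult)
qed

section \<open>Exit probabilities and the maximum principle\<close>

text \<open>The one-step expectation of \<open>f\<close> extended by 0 to the cemetery. Subsolutions
  satisfy \<open>f \<le> krw_avg k f\<close>, supersolutions the reverse.\<close>

definition krw_avg :: "(site \<Rightarrow> real) \<Rightarrow> (site \<Rightarrow> real) \<Rightarrow> site \<Rightarrow> real" where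
  "krw_avg k f x = (1 - k x) / 4 * (\<Sum>y | adj x y. f y)"

lemma krw_avg_eq:
  "krw_avg k f (a, b) = (1 - k (a, b)) / 4 * (f (a + 1, b) + f (a - 1, b) + f (a, b + 1) + f (a, b - 1))"
  unfolding krw_avg_def neighbours_eq by simp

lemma adj_iff: "adj (a, b) y \<longleftrightarrow> y \<in> {(a + 1, b), (a - 1, b), (a, b + 1), (a, b - 1)}"
  using neighbours_eq[of "(a, b)"] by auto

lemma sets_exit_before_killing: "exit_before_killing L \<in> sets (PiM UNIV (\<lambda>_. count_space UNIV))"
  unfolding exit_before_killing_def by (rule sets_hit_less)

lemma exit_before_killing_iff:
  "\<omega> \<in> exit_before_killing L \<longleftrightarrow> (\<exists>n. \<omega> n \<in> Some ` (- L) \<and> (\<forall>m\<le>n. \<omega> m \<noteq> None))"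
  unfolding exit_before_killing_def by (simp add: hit_less_iff)

lemma exit_before_killing_shift:
  assumes "\<omega> 0 = Some x" "x \<in> L"
  shows "\<omega> \<in> exit_before_killing L \<longleftrightarrow> (\<lambda>i. \<omega> (Suc i)) \<in> exit_before_killing L"
proof
  assume "\<omega> \<in> exit_before_killing L"
  then obtain n where n: "\<omega> n \<in> Some ` (- L)" "\<forall>m\<le>n. \<omega> m \<noteq> None"
    unfolding exit_before_killing_iff by blast
  then obtain n' where "n = Suc n'" using assms by (cases n) auto
  then show "(\<lambda>i. \<omega> (Suc i)) \<in> exit_before_killing L"
    using n unfolding exit_before_killing_iff by (auto intro!: exI[of _ n'])
next
  assume "(\<lambda>i. \<omega> (Suc i)) \<in> exit_before_killing L"
  then obtain n where n: "\<omega> (Suc n) \<in> Some ` (- L)" "\<forall>m\<le>n. \<omega> (Suc m) \<noteq> None"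
    unfolding exit_before_killing_iff by blast
  have "\<omega> m \<noteq> None" if "m \<le> Suc n" for m
    using n(2) assms(1) that by (cases m) auto
  then show "\<omega> \<in> exit_before_killing L"
    using n unfolding exit_before_killing_iff by blast
qed

lemma exit_prob_nonneg: "0 \<le> exit_prob k L x"
  by (simp add: exit_prob_def)

lemma exit_prob_le_1: "exit_prob k L x \<le> 1"
  unfolding exit_prob_def krw_law_def
  by (rule prob_space.prob_le_1[OF prob_space_mc_law])

lemma exit_prob_off:
  assumes "x \<notin> L" shows "exit_prob k L x = 1"
proof -
  interpret prob_space "mc_law (krw_kernel k) (Some x)" by (rule prob_space_mc_law)
  have "AE \<omega> in mc_law (krw_kernel k) (Some x). \<omega> \<in> exit_before_killing L"
    using AE_mc_law_start[where K = "krw_kernel k" and x = "Some x"]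
    by eventually_elim (use assms in \<open>unfold exit_before_killing_iff, intro exI[of _ 0], simp\<close>)
  then show ?thesis
    unfolding exit_prob_def krw_law_def
    by (subst (asm) AE_in_set_eq_1) (simp_all add: sets_exit_before_killing)
qed

lemma sets_path_coordinate: "{\<omega>. \<omega> i = z} \<in> sets (PiM UNIV (\<lambda>_::nat. count_space UNIV))"
proof -
  have "{\<omega> \<in> space (PiM UNIV (\<lambda>_::nat. count_space UNIV)). \<omega> i = z} \<in> sets (PiM UNIV (\<lambda>_. count_space UNIV))"
    by measurable
  then show ?thesis by (simp add: space_PiM)
qed

lemma exit_first_step:
  assumes x: "x \<in> L"
  shows "measure (krw_law k x) {\<omega> \<in> exit_before_killing L. \<omega> (Suc 0) = z} =
    pmf (krw_kernel k (Some x)) z * measure (mc_law (krw_kernel k) z) (exit_before_killing L)"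
proof -
  have sh: "{\<omega>. \<omega> (Suc 0) = z \<and> (\<lambda>i. \<omega> (Suc i)) \<in> exit_before_killing L} \<in> sets (mc_law K v)" for K v
  proof -
    have "(\<lambda>\<omega> i. \<omega> (Suc i)) -` exit_before_killing L \<in> sets (PiM UNIV (\<lambda>_. count_space UNIV))"
      using measurable_sets[OF measurable_path_shift sets_exit_before_killing[of L]]
      by (simp add: space_PiM)
    from sets.Int[OF sets_path_coordinate[of "Suc 0" z] this] show ?thesis
      by (simp add: vimage_def Collect_conj_eq)
  qed
  have "measure (krw_law k x) {\<omega> \<in> exit_before_killing L. \<omega> (Suc 0) = z} =
      measure (krw_law k x) {\<omega>. \<omega> (Suc 0) = z \<and> (\<lambda>i. \<omega> (Suc i)) \<in> exit_before_killing L}"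
    unfolding krw_law_def
  proof (rule measure_eq_AE)
    show "AE \<omega> in mc_law (krw_kernel k) (Some x). (\<omega> \<in> {\<omega> \<in> exit_before_killing L. \<omega> (Suc 0) = z}) =
        (\<omega> \<in> {\<omega>. \<omega> (Suc 0) = z \<and> (\<lambda>i. \<omega> (Suc i)) \<in> exit_before_killing L})"
      using AE_mc_law_start[where K = "krw_kernel k" and x = "Some x"]
      by eventually_elim (use exit_before_killing_shift x in auto)
    show "{\<omega> \<in> exit_before_killing L. \<omega> (Suc 0) = z} \<in> sets (mc_law (krw_kernel k) (Some x))"
      using sets.Int[OF sets_path_coordinate[of "Suc 0" z] sets_exit_before_killing[of L]]
      by (simp add: Int_def conj_commute)
  qed (rule sh)
  also have "\<dots> = pmf (krw_kernel k (Some x)) z * measure (mc_law (krw_kernel k) z) (exit_before_killing L)"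
    unfolding krw_law_def by (rule mc_law_first_step[OF sets_exit_before_killing])
  finally show ?thesis .
qed

lemma measure_exit_cemetery: "measure (mc_law K None) (exit_before_killing L) = 0"
proof -
  interpret prob_space "mc_law K None" by (rule prob_space_mc_law)
  have "AE \<omega> in mc_law K None. \<omega> \<notin> exit_before_killing L"
    using AE_mc_law_start[where K = K and x = None]
    by eventually_elim (auto simp: exit_before_killing_iff)
  then show ?thesis
    by (intro measure_eq_0_null_sets) (auto simp: AE_iff_null_sets sets_exit_before_killing)
qed

context
  fixes k :: "site \<Rightarrow> real"
  assumes k_range: "\<And>x. 0 \<le> k x" "\<And>x. k x \<le> 1"
begin

lemma exit_first_step_site:
  assumes "x \<in> L"
  shows "measure (krw_law k x) {\<omega> \<in> exit_before_killing L. \<omega> (Suc 0) = Some y} =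
    (if adj x y then (1 - k x) / 4 * exit_prob k L y else 0)"
  unfolding exit_first_step[OF assms] by (simp add: pmf_krw_kernel k_range exit_prob_def krw_law_def)

lemma exit_prob_avg:
  assumes x: "x \<in> L"
  shows "exit_prob k L x = krw_avg k (exit_prob k L) x"
proof -
  interpret prob_space "krw_law k x" unfolding krw_law_def by (rule prob_space_mc_law)
  let ?E = "\<lambda>z. {\<omega> \<in> exit_before_killing L. \<omega> (Suc 0) = z}"
  have mE: "?E z \<in> events" for z
    using sets.Int[OF sets_path_coordinate[of "Suc 0" z] sets_exit_before_killing[of L]]
    by (simp add: krw_law_def Int_def conj_commute)
  \<comment> \<open>From the cemetery there is no exit, and a jump to a non-neighbour has
    probability 0; only the four neighbours remain as first steps.\<close>
  have zero: "prob (?E z) = 0" if "z \<notin> Some ` {y. adj x y}" for z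
  proof (cases z)
    case None
    then show ?thesis by (simp add: exit_first_step[OF x] measure_exit_cemetery)
  next
    case (Some y)
    then show ?thesis using that exit_first_step_site[OF x, of y] by auto
  qed
  have "exit_prob k L x = prob (\<Union>z. ?E z)"
    unfolding exit_prob_def by (rule arg_cong[where f = prob]) auto
  also have "\<dots> = prob (\<Union>z\<in>Some ` {y. adj x y}. ?E z)"
  proof (rule measure_eq_AE)
    have "AE \<omega> in krw_law k x. \<forall>z. z \<notin> Some ` {y. adj x y} \<longrightarrow> \<omega> \<notin> ?E z"
      unfolding AE_all_countable
      by (intro allI AE_impI) (use mE zero in \<open>auto simp: prob_eq_0\<close>)
    then show "AE \<omega> in krw_law k x. (\<omega> \<in> (\<Union>z. ?E z)) = (\<omega> \<in> (\<Union>z\<in>Some ` {y. adj x y}. ?E z))"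
      by eventually_elim blast
  qed (use mE in \<open>auto intro!: sets.countable_UN'\<close>)
  also have "\<dots> = (\<Sum>z\<in>Some ` {y. adj x y}. prob (?E z))"
    by (rule finite_measure_finite_Union) (use mE in \<open>auto simp: finite_neighbours disjoint_family_on_def\<close>)
  also have "\<dots> = (\<Sum>y | adj x y. prob (?E (Some y)))"
    by (subst sum.reindex) auto
  also have "\<dots> = krw_avg k (exit_prob k L) x"
    unfolding krw_avg_def exit_first_step_site[OF x] sum_distrib_left by (rule sum.cong) auto
  finally show ?thesis .
qed

lemma krw_avg_diff: "krw_avg k (\<lambda>x. f x - g x) z = krw_avg k f z - krw_avg k g z"
  by (simp add: krw_avg_def sum_subtractf algebra_simps)

text \<open>Positive killing makes this immediate: at a site \<open>z\<close> attaining a positive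
  maximum \<open>M\<close>, the averages give \<open>M \<le> (1 - k z) * M\<close>.\<close>

lemma maximum_principle:
  assumes fin: "finite L" and pos: "\<And>x. x \<in> L \<Longrightarrow> 0 < k x"
    and sub: "\<And>x. x \<in> L \<Longrightarrow> f x \<le> krw_avg k f x"
    and bd: "\<And>x y. x \<in> L \<Longrightarrow> adj x y \<Longrightarrow> y \<notin> L \<Longrightarrow> f y \<le> 0"
    and x: "x \<in> L"
  shows "f x \<le> 0"
proof -
  define M where "M = Max (f ` L)"
  have "M \<in> f ` L" unfolding M_def using fin x by (intro Max_in) auto
  then obtain z where z: "z \<in> L" "f z = M" by auto
  have le: "f y \<le> M" if "y \<in> L" for y
    unfolding M_def using that fin by auto
  have "M \<le> 0"
  proof (rule ccontr)
    assume "\<not> M \<le> 0"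
    then have M: "M > 0" by simp
    have "f y \<le> M" if "adj z y" for y
      using le[of y] bd[OF z(1) that] M by (cases "y \<in> L") auto
    then have "(\<Sum>y | adj z y. f y) \<le> (\<Sum>y | adj z y. M)"
      by (intro sum_mono) auto
    then have "krw_avg k f z \<le> (1 - k z) / 4 * (4 * M)"
      unfolding krw_avg_def using k_range(2)[of z] card_neighbours[of z] by (intro mult_left_mono) auto
    with sub[OF z(1)] z(2) have "k z * M \<le> 0" by (simp add: algebra_simps)
    then show False using pos[OF z(1)] M by (simp add: mult_le_0_iff)
  qed
  then show ?thesis using le[OF x] by simp
qed

text \<open>The maximum principle for \<open>f - exit_prob k L\<close>, which is at most 0 on the
  outer boundary since the exit probability is 1 there. With \<open>exit_prob_le\<close> it turns
  barriers into bounds.\<close>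

lemma exit_prob_ge:
  assumes "finite L" "\<And>x. x \<in> L \<Longrightarrow> 0 < k x" "\<And>x. x \<in> L \<Longrightarrow> f x \<le> krw_avg k f x"
    and bd: "\<And>x y. x \<in> L \<Longrightarrow> adj x y \<Longrightarrow> y \<notin> L \<Longrightarrow> f y \<le> 1" and "x \<in> L"
  shows "f x \<le> exit_prob k L x"
proof -
  have "f x - exit_prob k L x \<le> 0"
  proof (rule maximum_principle[of L])
    fix z assume z: "z \<in> L"
    show "f z - exit_prob k L z \<le> krw_avg k (\<lambda>x. f x - exit_prob k L x) z"
      unfolding krw_avg_diff exit_prob_avg[OF z, symmetric] using assms(3)[OF z] by simp
  qed (use assms in \<open>auto simp: exit_prob_off\<close>)
  then show ?thesis by simp
qed

lemma exit_prob_le: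
  assumes "finite L" "\<And>x. x \<in> L \<Longrightarrow> 0 < k x" "\<And>x. x \<in> L \<Longrightarrow> krw_avg k f x \<le> f x"
    and bd: "\<And>x y. x \<in> L \<Longrightarrow> adj x y \<Longrightarrow> y \<notin> L \<Longrightarrow> 1 \<le> f y" and "x \<in> L"
  shows "exit_prob k L x \<le> f x"
proof -
  have "exit_prob k L x - f x \<le> 0"
  proof (rule maximum_principle[of L])
    fix z assume z: "z \<in> L"
    show "exit_prob k L z - f z \<le> krw_avg k (\<lambda>x. exit_prob k L x - f x) z"
      unfolding krw_avg_diff exit_prob_avg[OF z, symmetric] using assms(3)[OF z] by simp
  qed (use assms in \<open>auto simp: exit_prob_off\<close>)
  then show ?thesis by simp
qed

lemma exit_prob_adj_ge:
  assumes "x \<in> L" "adj x y"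
  shows "(1 - k x) / 4 * exit_prob k L y \<le> exit_prob k L x"
proof -
  have "exit_prob k L y \<le> (\<Sum>y | adj x y. exit_prob k L y)"
    using assms(2) by (intro member_le_sum) (auto simp: finite_neighbours exit_prob_nonneg)
  then show ?thesis
    unfolding exit_prob_avg[OF assms(1)] krw_avg_def using k_range(2)[of x]
    by (intro mult_left_mono) auto
qed

text \<open>An escape path leaves the finite set \<open>L\<close> at some index; positivity is
  carried back from there, each step costing a factor \<open>(1 - k (p i)) / 4 > 0\<close>.\<close>

lemma exit_prob_pos:
  assumes fin: "finite L" and esc: "x \<in> escape_set k"
  shows "0 < exit_prob k L x"
proof -
  obtain p where p: "p 0 = x" "\<And>i. adj (p i) (p (Suc i))" "\<And>i. k (p i) < 1"
    and lim: "filterlim (\<lambda>i. znorm (p i)) at_top sequentially"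
    using esc unfolding escape_set_def by blast
  have "\<exists>n. p n \<notin> L"
  proof (cases "L = {}")
    case False
    have "eventually (\<lambda>i. znorm (p i) > Max (znorm ` L)) sequentially"
      using lim unfolding filterlim_at_top_dense by blast
    then obtain n where "znorm (p n) > Max (znorm ` L)"
      by (auto simp: eventually_sequentially)
    then have "p n \<notin> L" using fin by (meson Max_ge finite_imageI imageI leD)
    then show ?thesis ..
  qed simp
  then obtain n where "p n \<notin> L" ..
  have "0 < exit_prob k L (p i)" if "i \<le> n" for i
    using that
  proof (induction i rule: inc_induct)
    case base then show ?case using \<open>p n \<notin> L\<close> by (simp add: exit_prob_off)
  next
    case (step i)
    show ?case
    proof (cases "p i \<in> L")
      case True
      have "0 < (1 - k (p i)) / 4 * exit_prob k L (p (Suc i))"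
        using step.IH p(3)[of i] by simp
      also have "\<dots> \<le> exit_prob k L (p i)" by (rule exit_prob_adj_ge[OF True p(2)])
      finally show ?thesis .
    qed (simp add: exit_prob_off)
  qed
  from this[of 0] show ?thesis using p(1) by simp
qed

end

text \<open>The reflected exit probability is harmonic in \<open>L\<close> with the same boundary
  value 1, so comparison in both directions identifies the two, without a symmetry of the path
  law.\<close>

lemma exit_prob_reflect:
  assumes k: "\<And>x. 0 < k x" "\<And>x. k x \<le> 1" "\<And>a b. k (- a, b) = k (a, b)"
    and L: "finite L" "\<And>a b. (- a, b) \<in> L \<longleftrightarrow> (a, b) \<in> L"
  shows "exit_prob k L (- a, b) = exit_prob k L (a, b)"
proof (cases "(a, b) \<in> L")
  case False
  then show ?thesis using L(2) by (simp add: exit_prob_off)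
next
  case True
  note kr = less_imp_le[OF k(1)] k(2)
  let ?f = "\<lambda>x. exit_prob k L (- fst x, snd x)"
  have h: "krw_avg k ?f x = ?f x" if x: "x \<in> L" for x
  proof (cases x)
    case (Pair c d)
    then have *: "(- c, d) \<in> L" using x L(2) by simp
    have e: "- (c + 1) = - c - 1" "- (c - 1) = - c + 1" by auto
    have "krw_avg k ?f (c, d) = krw_avg k (exit_prob k L) (- c, d)"
      unfolding krw_avg_eq k(3) fst_conv snd_conv e
      by (rule arg_cong[where f = "\<lambda>z. (1 - k (c, d)) / 4 * z"]) linarith
    then show ?thesis
      unfolding Pair exit_prob_avg[OF kr *, symmetric] by simp
  qed
  have off: "?f y = 1" if "y \<notin> L" for y
    using that L(2)[of "fst y" "snd y"] by (simp add: exit_prob_off)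
  have "?f (a, b) \<le> exit_prob k L (a, b)"
    by (rule exit_prob_ge[OF kr L(1) k(1) eq_refl[OF h[symmetric]] exit_prob_le_1 True])
  moreover have "exit_prob k L (a, b) \<le> ?f (a, b)"
    by (rule exit_prob_le[OF kr L(1) k(1) eq_refl[OF h] eq_refl[OF off[symmetric]] True])
  ultimately show ?thesis by simp
qed

section \<open>Ratios of exit probabilities when the conditioned walk is well defined\<close>

text \<open>A single limit \<open>l\<close> serves all exhaustions. The second site is in the
  numerator, so limits multiply along a path.\<close>

definition exit_ratio_limit :: "(site \<Rightarrow> real) \<Rightarrow> site \<Rightarrow> site \<Rightarrow> real \<Rightarrow> bool" where
  "exit_ratio_limit k x y l \<longleftrightarrow> (\<forall>\<Lambda>. exhaustion \<Lambda> \<longrightarrow>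
     (\<lambda>R. exit_prob k (\<Lambda> R) y / exit_prob k (\<Lambda> R) x) \<longlonglongrightarrow> l)"

lemma integral_indicator_step:
  fixes M :: "(nat \<Rightarrow> 'a) measure"
  assumes "space M = UNIV"
  shows "(\<integral>\<omega>. indicator {z} (map \<omega> [0..<Suc 1] ! 1) \<partial>M) = measure M {\<omega>. \<omega> (Suc 0) = z}"
proof -
  have "(\<lambda>\<omega>. indicator {z} (map \<omega> [0..<Suc 1] ! 1) :: real) = indicator {\<omega>. \<omega> (Suc 0) = z}"
    by (auto simp: fun_eq_iff indicator_def simp del: upt_Suc)
  then show ?thesis using assms by simp
qed

context
  fixes k :: "site \<Rightarrow> real"
  assumes k_range: "\<And>x. 0 \<le> k x" "\<And>x. k x \<le> 1"
    and wd: "conditioned_krw_well_defined k"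
begin

text \<open>Under the conditioned law the first step goes to \<open>y\<close> with probability
  \<open>(1 - k x) / 4\<close> times the ratio of the exit probabilities at \<open>y\<close> and
  \<open>x\<close>; convergence of the former gives that of the latter.\<close>

lemma exit_ratio_limit_adj_exists:
  assumes x: "x \<in> escape_set k" and adj: "adj x y"
  shows "\<exists>l. exit_ratio_limit k x y l"
proof -
  obtain K where K: "\<And>\<Lambda>. exhaustion \<Lambda> \<Longrightarrow> converges_in_distribution
             (\<lambda>R. uniform_measure (krw_law k x) (exit_before_killing (\<Lambda> R))) (mc_law K (Some x))"
    using wd x unfolding conditioned_krw_well_defined_def by metis
  have kx: "k x < 1" using x unfolding escape_set_def by (auto dest: spec[of _ 0])
  define c where "c = measure (mc_law K (Some x)) {\<omega>. \<omega> (Suc 0) = Some y}"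
  have "(\<lambda>R. exit_prob k (\<Lambda> R) y / exit_prob k (\<Lambda> R) x) \<longlonglongrightarrow> c * (4 / (1 - k x))"
    if ex: "exhaustion \<Lambda>" for \<Lambda>
  proof -
    let ?U = "\<lambda>R. uniform_measure (krw_law k x) (exit_before_killing (\<Lambda> R))"
    have "bounded (range (\<lambda>xs. indicator {Some y} (xs ! 1) :: real))"
      by (rule boundedI[of _ 1]) (auto simp: indicator_def)
    from K[OF ex, unfolded converges_in_distribution_def, THEN spec[of _ 1], THEN spec, THEN mp, OF this]
    have lim: "(\<lambda>R. measure (?U R) {\<omega>. \<omega> (Suc 0) = Some y}) \<longlonglongrightarrow> c"
      unfolding c_def by (subst (asm) (1 2) integral_indicator_step) (simp_all add: krw_law_def)
    \<comment> \<open>The first-step identity holds only when the walk starts inside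
      \<open>\<Lambda> R\<close>, that is from \<open>R0\<close> on.\<close>
    obtain R0 where R0: "x \<in> \<Lambda> R0" using ex unfolding exhaustion_def by blast
    have eq: "measure (?U R) {\<omega>. \<omega> (Suc 0) = Some y} * (4 / (1 - k x)) =
        exit_prob k (\<Lambda> R) y / exit_prob k (\<Lambda> R) x" if "R \<ge> R0" for R
    proof -
      interpret prob_space "krw_law k x" unfolding krw_law_def by (rule prob_space_mc_law)
      have xR: "x \<in> \<Lambda> R" using ex R0 that unfolding exhaustion_def incseq_def by blast
      have pos: "0 < exit_prob k (\<Lambda> R) x"
        using ex by (intro exit_prob_pos[OF k_range _ x]) (auto simp: exhaustion_def)
      have "measure (?U R) {\<omega>. \<omega> (Suc 0) = Some y} =
          measure (krw_law k x) (exit_before_killing (\<Lambda> R) \<inter> {\<omega>. \<omega> (Suc 0) = Some y}) /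
          measure (krw_law k x) (exit_before_killing (\<Lambda> R))"
      proof (rule measure_uniform_measure)
        show "emeasure (krw_law k x) (exit_before_killing (\<Lambda> R)) \<noteq> 0"
          using pos by (simp add: exit_prob_def emeasure_eq_measure)
        show "emeasure (krw_law k x) (exit_before_killing (\<Lambda> R)) \<noteq> \<infinity>"
          by (simp add: emeasure_eq_measure)
      qed (simp add: krw_law_def sets_path_coordinate)
      also have "\<dots> = (1 - k x) / 4 * exit_prob k (\<Lambda> R) y / exit_prob k (\<Lambda> R) x"
        using exit_first_step_site[OF k_range xR] adj by (simp add: Int_def exit_prob_def)
      finally show ?thesis using kx by simp
    qed
    show ?thesis
      by (rule Lim_transform_eventually[OF tendsto_mult_right[OF lim]])
        (use eq in \<open>auto simp: eventually_sequentially\<close>)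
  qed
  then show ?thesis unfolding exit_ratio_limit_def by blast
qed

lemma exit_ratio_limit_trans:
  assumes "exit_ratio_limit k x y l" "exit_ratio_limit k y z m" and y: "y \<in> escape_set k"
  shows "exit_ratio_limit k x z (l * m)"
  unfolding exit_ratio_limit_def
proof (intro allI impI)
  fix \<Lambda> assume ex: "exhaustion \<Lambda>"
  have "0 < exit_prob k (\<Lambda> R) y" for R
    using ex by (intro exit_prob_pos[OF k_range _ y]) (auto simp: exhaustion_def)
  then have "exit_prob k (\<Lambda> R) y / exit_prob k (\<Lambda> R) x * (exit_prob k (\<Lambda> R) z / exit_prob k (\<Lambda> R) y) =
      exit_prob k (\<Lambda> R) z / exit_prob k (\<Lambda> R) x" for R
    by (simp add: less_imp_neq[THEN not_sym])
  moreover have "(\<lambda>R. exit_prob k (\<Lambda> R) y / exit_prob k (\<Lambda> R) x * (exit_prob k (\<Lambda> R) z / exit_prob k (\<Lambda> R) y))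
      \<longlonglongrightarrow> l * m"
    using assms ex unfolding exit_ratio_limit_def by (intro tendsto_mult) auto
  ultimately show "(\<lambda>R. exit_prob k (\<Lambda> R) z / exit_prob k (\<Lambda> R) x) \<longlonglongrightarrow> l * m" by simp
qed

lemma exit_ratio_limit_path:
  assumes "\<And>i. p i \<in> escape_set k" "\<And>i. i < n \<Longrightarrow> adj (p i) (p (Suc i))"
  shows "\<exists>l. exit_ratio_limit k (p 0) (p n) l"
  using assms(2)
proof (induction n)
  case 0
  have "0 < exit_prob k (\<Lambda> R) (p 0)" if "exhaustion \<Lambda>" for \<Lambda> R
    using that by (intro exit_prob_pos[OF k_range _ assms(1)]) (auto simp: exhaustion_def)
  then have "exit_prob k (\<Lambda> R) (p 0) / exit_prob k (\<Lambda> R) (p 0) = 1" if "exhaustion \<Lambda>" for \<Lambda> R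
    using that by (metis divide_self less_numeral_extra(3))
  then have "exit_ratio_limit k (p 0) (p 0) 1"
    unfolding exit_ratio_limit_def by simp
  then show ?case by blast
next
  case (Suc n)
  then obtain l where l: "exit_ratio_limit k (p 0) (p n) l" by auto
  obtain m where "exit_ratio_limit k (p n) (p (Suc n)) m"
    using exit_ratio_limit_adj_exists[OF assms(1) Suc.prems] by blast
  from exit_ratio_limit_trans[OF l this assms(1)] show ?case by blast
qed

end

text \<open>The origin and its four neighbours are the sites where \<open>kill \<alpha>\<close>
  equals 1; the second assumption excludes exactly these.\<close>

lemma kill_less_1:
  assumes "0 < \<alpha>" "1 < a\<^sup>2 + b\<^sup>2"
  shows "kill \<alpha> (a, b) < 1"
proof -
  have "1 < real_of_int (a\<^sup>2 + b\<^sup>2)" using assms(2) by (simp only: of_int_1_less_iff)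
  then have "1 < znorm (a, b)" by (simp only: znorm_eq fst_conv snd_conv real_sqrt_gt_1_iff)
  then have "znorm (a, b) powr (- \<alpha>) < 1" using assms(1) by (intro powr_less_one) auto
  then show ?thesis unfolding kill_def using assms(2) by auto
qed

lemma mem_escape_set_kill:
  assumes \<alpha>: "0 < \<alpha>" and s: "1 < a\<^sup>2 + b\<^sup>2"
  shows "(a, b) \<in> escape_set (kill \<alpha>)"
proof -
  \<comment> \<open>The direction pointing away from the vertical axis, so that the norm never
    decreases along the horizontal ray \<open>p\<close>.\<close>
  define e :: int where "e = (if a \<ge> 0 then 1 else - 1)"
  define p where "p = (\<lambda>i::nat. (a + int i * e, b))"
  have abs: "\<bar>a + int i * e\<bar> = \<bar>a\<bar> + int i" for i unfolding e_def by auto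
  have "\<bar>a\<bar> \<le> \<bar>a + int i * e\<bar>" for i unfolding abs by simp
  then have "1 < (a + int i * e)\<^sup>2 + b\<^sup>2" for i
    using s abs_le_square_iff[of a "a + int i * e"] by (smt (verit))
  then have "kill \<alpha> (p i) < 1" for i
    unfolding p_def by (intro kill_less_1 \<alpha>)
  moreover have "adj (p i) (p (Suc i))" for i
    unfolding p_def adj_iff e_def by (auto simp: algebra_simps)
  moreover have "filterlim (\<lambda>i. znorm (p i)) at_top sequentially"
  proof (rule filterlim_at_top_mono[OF filterlim_real_sequentially always_eventually], rule allI)
    fix i
    have "real i \<le> \<bar>real_of_int (a + int i * e)\<bar>" using abs[of i] by linarith
    also have "\<dots> \<le> znorm (p i)"
      unfolding p_def znorm_eq by (simp add: real_sqrt_abs2[symmetric] power2_eq_square del: real_sqrt_abs2)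
    finally show "real i \<le> znorm (p i)" .
  qed
  ultimately show ?thesis
    unfolding escape_set_def by (auto intro!: exI[of _ p] simp: p_def)
qed

lemma exit_ratio_limit_axis:
  assumes wd: "conditioned_krw_well_defined (kill \<alpha>)" and \<alpha>: "0 < \<alpha>" and a: "1 < a"
  shows "\<exists>l. exit_ratio_limit (kill \<alpha>) (- int a, 0) (int a, 0) l"
proof -
  let ?a = "int a"
  have sq: "1 < ?a\<^sup>2" using a by (simp add: one_less_power)
  \<comment> \<open>The path follows the upper half of the boundary of the square of half-width
    \<open>a\<close>, avoiding the sites near the origin where survival is impossible. It stays at
    its end point after \<open>4 * a\<close>, because \<open>exit_ratio_limit_path\<close> wants
    every \<open>p i\<close> in the escape set.\<close>
  define p where "p = (\<lambda>i. if i \<le> a then (- ?a, int i)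
     else if i \<le> 3 * a then (int i - 2 * ?a, ?a) else if i \<le> 4 * a then (?a, 4 * ?a - int i) else (?a, 0))"
  have esc: "p i \<in> escape_set (kill \<alpha>)" for i
  proof -
    obtain c d where cd: "p i = (c, d)" by (cases "p i")
    then have "c\<^sup>2 = ?a\<^sup>2 \<or> d\<^sup>2 = ?a\<^sup>2"
      unfolding p_def by (auto split: if_splits)
    then have "1 < c\<^sup>2 + d\<^sup>2" using sq zero_le_power2[of c] zero_le_power2[of d] by linarith
    then show ?thesis unfolding cd(1) by (rule mem_escape_set_kill[OF \<alpha>])
  qed
  have adj: "adj (p i) (p (Suc i))" if "i < 4 * a" for i
    using that unfolding p_def by (auto simp: adj_iff)
  have "p 0 = (- ?a, 0)" "p (4 * a) = (?a, 0)" using a by (auto simp: p_def)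
  then show ?thesis
    using exit_ratio_limit_path[OF kill_range wd, of p "4 * a"] esc adj by auto
qed

section \<open>Expansion of the radial profiles\<close>

text \<open>The WKB profile in the squared norm. It is used with \<open>c = p / 2\<close> (main
  term), \<open>c = p\<close> (correction) and, multiplied by the first coordinate,
  \<open>c = p / 2 + 1 / 2\<close>.\<close>

definition radial :: "real \<Rightarrow> real \<Rightarrow> real \<Rightarrow> real" where
  "radial p c s = exp (s powr p / p) * s powr (- c)"

lemma radial_pos: "0 < s \<Longrightarrow> 0 < radial p c s"
  by (simp add: radial_def)

lemma abs_binomial_remainder:
  fixes p t :: real
  assumes p: "0 < p" "p \<le> 1" and t: "\<bar>t\<bar> \<le> 1 / 2"
  shows "\<bar>((1 + t) powr p - 1) / p - (t + (p - 1) / 2 * t\<^sup>2)\<bar> \<le> 3 * \<bar>t\<bar> ^ 3"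
proof -
  \<comment> \<open>The successive derivatives in the form \<open>Maclaurin_bi_le\<close> expects;
    the last branch stands for the third derivative and is only evaluated at 3.\<close>
  define D where "D = (\<lambda>m x::real. (case m of 0 \<Rightarrow> (1 + x) powr p | Suc 0 \<Rightarrow> p * (1 + x) powr (p - 1)
      | Suc (Suc 0) \<Rightarrow> p * (p - 1) * (1 + x) powr (p - 2)
      | _ \<Rightarrow> p * (p - 1) * (p - 2) * (1 + x) powr (p - 3)))"
  have D0: "D 0 = (\<lambda>x. (1 + x) powr p)" and D1: "D 1 = (\<lambda>x. p * (1 + x) powr (p - 1))"
    and D2: "D 2 = (\<lambda>x. p * (p - 1) * (1 + x) powr (p - 2))"
    and D3: "D 3 = (\<lambda>x. p * (p - 1) * (p - 2) * (1 + x) powr (p - 3))"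
    by (auto simp: D_def numeral_2_eq_2 numeral_3_eq_3)
  have "DERIV (D m) x :> D (Suc m) x" if "m < 3" "\<bar>x\<bar> \<le> \<bar>t\<bar>" for m x
  proof -
    have x: "0 < 1 + x" using that t by linarith
    have 1: "DERIV (D 0) x :> D 1 x" unfolding D0 D1
      using x by (auto intro!: derivative_eq_intros)
    have 2: "DERIV (D 1) x :> D 2 x" unfolding D1 D2
      using x by (auto intro!: derivative_eq_intros simp: algebra_simps)
    have 3: "DERIV (D 2) x :> D 3 x" unfolding D2 D3
      using x by (auto intro!: derivative_eq_intros simp: algebra_simps)
    have "m = 0 \<or> m = 1 \<or> m = 2" using that(1) by auto
    then show ?thesis using 1 2 3 by (auto simp: numeral_2_eq_2 numeral_3_eq_3)
  qed
  then obtain x where x: "\<bar>x\<bar> \<le> \<bar>t\<bar>" and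
    eq: "D 0 t = (\<Sum>m<3. D m 0 / fact m * t ^ m) + D 3 x / fact 3 * t ^ 3"
    using Maclaurin_bi_le[of D "D 0" 3 t] by blast
  have sum: "(\<Sum>m<3. D m 0 / fact m * t ^ m) = 1 + p * t + p * (p - 1) / 2 * t\<^sup>2"
    using D0 D1 D2 by (simp add: eval_nat_numeral)
  have f3: "fact 3 = (6::real)" by (simp add: eval_nat_numeral)
  \<comment> \<open>This factor is at most 8 and \<open>\<bar>(p - 1) * (p - 2)\<bar>\<close> at
    most 2, so the remainder has the coefficient 16/6, below 3.\<close>
  have "(1 + x) powr (p - 3) \<le> (1 / 2) powr (p - 3)"
    using x t p by (intro powr_mono2') auto
  also have "\<dots> \<le> (1 / 2) powr (- 3)"
    using p by (intro powr_mono') auto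
  also have "\<dots> = 8" by (simp add: powr_minus powr_numeral power3_eq_cube)
  finally have "(1 + x) powr (p - 3) \<le> 8" .
  moreover have "\<bar>(p - 1) * (p - 2)\<bar> \<le> 1 * 2"
    unfolding abs_mult using p by (intro mult_mono) auto
  ultimately have "\<bar>(p - 1) * (p - 2)\<bar> * (1 + x) powr (p - 3) \<le> 2 * 8"
    by (intro mult_mono) auto
  then have b: "\<bar>(p - 1) * (p - 2) * (1 + x) powr (p - 3)\<bar> \<le> 16" by (simp add: abs_mult)
  have "((1 + t) powr p - 1) / p - (t + (p - 1) / 2 * t\<^sup>2) =
     (p - 1) * (p - 2) * (1 + x) powr (p - 3) / 6 * t ^ 3"
    using eq p unfolding sum f3 D0 D3 by (simp add: field_simps)
  then have "\<bar>((1 + t) powr p - 1) / p - (t + (p - 1) / 2 * t\<^sup>2)\<bar> =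
     \<bar>(p - 1) * (p - 2) * (1 + x) powr (p - 3)\<bar> / 6 * \<bar>t\<bar> ^ 3"
    by (simp only: abs_mult abs_divide power_abs abs_numeral)
  also have "\<dots> \<le> 16 / 6 * \<bar>t\<bar> ^ 3"
    using b by (intro mult_right_mono divide_right_mono) auto
  also have "\<dots> \<le> 3 * \<bar>t\<bar> ^ 3"
    by (intro mult_right_mono) auto
  finally show ?thesis .
qed

lemma abs_exp_remainder:
  fixes x :: real
  assumes "\<bar>x\<bar> \<le> M"
  shows "\<bar>exp x - (1 + x + x\<^sup>2 / 2)\<bar> \<le> exp M * \<bar>x\<bar> ^ 3"
proof -
  obtain y where y: "\<bar>y\<bar> \<le> \<bar>x\<bar>"
    and eq: "exp x = (\<Sum>m<3. (x ^ m) / fact m) + exp y / fact 3 * x ^ 3"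
    using Maclaurin_exp_le[of x 3] by blast
  have "(\<Sum>m<3. (x ^ m) / fact m) = 1 + x + x\<^sup>2 / 2" by (simp add: eval_nat_numeral)
  then have "\<bar>exp x - (1 + x + x\<^sup>2 / 2)\<bar> = \<bar>exp y / 6 * x ^ 3\<bar>"
    using eq by (simp add: eval_nat_numeral)
  also have "\<dots> = exp y / 6 * \<bar>x\<bar> ^ 3" by (simp add: abs_mult power_abs)
  also have "\<dots> \<le> exp M * \<bar>x\<bar> ^ 3"
  proof (intro mult_right_mono)
    have "exp y \<le> exp M" using y assms by simp
    then show "exp y / 6 \<le> exp M" using exp_gt_zero[of M] by linarith
  qed simp
  finally show ?thesis .
qed

text \<open>Here \<open>m\<close> is $s^p$, \<open>t\<close> the relative increment of \<open>s\<close> and \<open>\<tau>\<close> is $s^{-1/2}$.\<close>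

lemma exponent_expansion:
  fixes m t \<tau> p c r E :: real
  assumes m: "1 \<le> m" and t: "\<bar>t\<bar> \<le> 3 * \<tau>" and \<tau>: "0 < \<tau>" "\<tau> \<le> 1 / 6" and m\<tau>: "m ^ 3 * \<tau> \<le> 1"
    and p: "0 < p" "p \<le> 1" and c: "0 \<le> c" "c \<le> 1"
    and E: "E = m * t + m * (p - 1) / 2 * t\<^sup>2 - c * t + r" and r: "\<bar>r\<bar> \<le> 3 * m * \<bar>t\<bar> ^ 3 + 2 * t\<^sup>2"
  shows "\<bar>E\<bar> \<le> 42"
    and "\<bar>exp E - (1 + m * t + m * (p - 1) / 2 * t\<^sup>2 - c * t + m\<^sup>2 * t\<^sup>2 / 2 - c * m * t\<^sup>2)\<bar>
       \<le> (968 + exp 42 * 42 ^ 3) * \<tau>\<^sup>2"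
proof -
  have m0: "0 \<le> m" using m by simp
  have t2: "t\<^sup>2 \<le> 9 * \<tau>\<^sup>2" using power_mono[OF t, of 2] by (simp add: power_mult_distrib)
  have t3: "\<bar>t\<bar> ^ 3 \<le> 27 * \<tau> ^ 3" using power_mono[OF t, of 3] by (simp add: power_mult_distrib)
  have m2: "m \<le> m ^ 3" "m\<^sup>2 \<le> m ^ 3"
    using power_increasing[of 1 3 m] power_increasing[of 2 3 m] m by auto
  have m\<tau>1: "m * \<tau> \<le> 1" "m\<^sup>2 * \<tau> \<le> 1"
    using mult_right_mono[OF m2(1), of \<tau>] mult_right_mono[OF m2(2), of \<tau>] m\<tau> \<tau>(1) by linarith+
  have m1: "m * \<bar>t\<bar> \<le> 3"
    using mult_left_mono[OF t m0] m\<tau>1 by linarith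
  have th: "\<bar>t\<bar> \<le> 1 / 2" using t \<tau> by linarith
  have cube: "\<bar>t\<bar> ^ 3 = \<bar>t\<bar> * t\<^sup>2" by (simp add: power3_eq_cube power2_eq_square)
  have ms: "m * (\<bar>t\<bar> * t\<^sup>2) \<le> m * (1 / 2 * t\<^sup>2)"
    using m th by (intro mult_left_mono mult_right_mono) auto
  have r1: "\<bar>r\<bar> \<le> 3 / 2 * (m * t\<^sup>2) + 2 * t\<^sup>2" using r ms unfolding cube by simp
  have tm: "t\<^sup>2 \<le> m * t\<^sup>2" using m mult_right_mono[of 1 m "t\<^sup>2"] by simp
  define q where "q = m * (p - 1) / 2 * t\<^sup>2 + r"
  have "\<bar>m * (p - 1) / 2 * t\<^sup>2\<bar> = (1 - p) * (m * t\<^sup>2 / 2)" using m p by (simp add: abs_mult)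
  also have "\<dots> \<le> 1 * (m * t\<^sup>2 / 2)" using p m by (intro mult_right_mono) auto
  finally have q: "\<bar>q\<bar> \<le> 4 * (m * t\<^sup>2)" unfolding q_def using r1 tm by linarith
  \<comment> \<open>Everything in \<open>E\<close> beyond the leading \<open>m * t\<close> is at
    most \<open>13 * \<bar>t\<bar>\<close>. Hence
    \<open>\<bar>E\<bar> \<le> 14 * (m * \<bar>t\<bar>)\<close>, and 42 arises from
    \<open>m * \<bar>t\<bar> \<le> 3\<close>.\<close>
  define w where "w = q - c * t"
  have mt2: "m * t\<^sup>2 \<le> 3 * \<bar>t\<bar>"
    using mult_right_mono[OF m1, of "\<bar>t\<bar>"] by (simp add: power2_eq_square mult.assoc)
  have ct: "\<bar>c * t\<bar> \<le> \<bar>t\<bar>" using c by (simp add: abs_mult mult_left_le_one_le)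
  have w: "\<bar>w\<bar> \<le> 13 * \<bar>t\<bar>" unfolding w_def using q mt2 ct by linarith
  have Ew: "E = m * t + w" unfolding E w_def q_def by simp
  have mt: "\<bar>t\<bar> \<le> m * \<bar>t\<bar>" using m mult_right_mono[of 1 m "\<bar>t\<bar>"] by simp
  have amt: "\<bar>m * t\<bar> = m * \<bar>t\<bar>" using m by (simp add: abs_mult)
  have E14: "\<bar>E\<bar> \<le> 14 * (m * \<bar>t\<bar>)" unfolding Ew using w mt amt by linarith
  then show E42: "\<bar>E\<bar> \<le> 42" using m1 by linarith
  have E42': "\<bar>E\<bar> \<le> 42 * (m * \<tau>)"
    using E14 mult_left_mono[OF t m0] by linarith
  have "\<bar>E\<bar> ^ 3 \<le> (42 * (m * \<tau>)) ^ 3" using E42' by (intro power_mono) auto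
  also have "\<dots> = 42 ^ 3 * (m ^ 3 * \<tau>) * \<tau>\<^sup>2"
    by (simp add: power_mult_distrib power3_eq_cube power2_eq_square)
  also have "\<dots> \<le> 42 ^ 3 * 1 * \<tau>\<^sup>2" using m\<tau> by (intro mult_right_mono mult_left_mono) auto
  finally have E3: "exp 42 * \<bar>E\<bar> ^ 3 \<le> exp 42 * (42 ^ 3 * \<tau>\<^sup>2)" by (intro mult_left_mono) auto
  have "m * (\<bar>t\<bar> ^ 3) \<le> m * (27 * \<tau> ^ 3)" using t3 m by (intro mult_left_mono) auto
  also have "\<dots> = 27 * (m * \<tau>) * \<tau>\<^sup>2" by (simp add: power3_eq_cube power2_eq_square)
  also have "\<dots> \<le> 27 * 1 * \<tau>\<^sup>2" using m\<tau>1 by (intro mult_right_mono mult_left_mono) auto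
  finally have r2: "\<bar>r\<bar> \<le> 99 * \<tau>\<^sup>2" using r t2 by linarith
  have "m\<^sup>2 * (\<bar>t\<bar> ^ 3) \<le> m\<^sup>2 * (27 * \<tau> ^ 3)" using t3 m by (intro mult_left_mono) auto
  also have "\<dots> = 27 * (m\<^sup>2 * \<tau>) * \<tau>\<^sup>2" by (simp add: power3_eq_cube power2_eq_square)
  also have "\<dots> \<le> 27 * 1 * \<tau>\<^sup>2" using m\<tau>1 by (intro mult_right_mono mult_left_mono) auto
  finally have m2t3: "m\<^sup>2 * \<bar>t\<bar> ^ 3 \<le> 27 * \<tau>\<^sup>2" by simp
  have "\<bar>2 * (m * t) * q\<bar> = 2 * (m * \<bar>t\<bar>) * \<bar>q\<bar>" using m by (simp add: abs_mult)
  also have "\<dots> \<le> 2 * (m * \<bar>t\<bar>) * (4 * (m * t\<^sup>2))" using q m by (intro mult_left_mono) auto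
  also have "\<dots> = 8 * (m\<^sup>2 * \<bar>t\<bar> ^ 3)" by (simp add: cube power2_eq_square)
  finally have q2: "\<bar>2 * (m * t) * q\<bar> \<le> 216 * \<tau>\<^sup>2" using m2t3 by linarith
  have "w\<^sup>2 \<le> (13 * \<bar>t\<bar>)\<^sup>2" using power_mono[OF w, of 2] by simp
  then have w2: "0 \<le> w\<^sup>2" "w\<^sup>2 \<le> 1521 * \<tau>\<^sup>2" using t2 by (simp_all add: power_mult_distrib)
  have E2: "E\<^sup>2 = m\<^sup>2 * t\<^sup>2 - 2 * c * m * t\<^sup>2 + 2 * (m * t) * q + w\<^sup>2"
    unfolding Ew w_def by (simp add: power2_eq_square algebra_simps)
  define P where "P = exp E - (1 + E + E\<^sup>2 / 2)"
  have P: "\<bar>P\<bar> \<le> exp 42 * 42 ^ 3 * \<tau>\<^sup>2"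
    unfolding P_def using abs_exp_remainder[OF E42] E3 by linarith
  have "exp E = P + 1 + E + E\<^sup>2 / 2" unfolding P_def by simp
  \<comment> \<open>The four discarded terms are bounded by \<open>exp 42 * 42 ^ 3\<close>, 99, 108
    and 1521/2 times \<open>\<tau>\<^sup>2\<close>; the last three sum to less than 968.\<close>
  then have "exp E - (1 + m * t + m * (p - 1) / 2 * t\<^sup>2 - c * t + m\<^sup>2 * t\<^sup>2 / 2 - c * m * t\<^sup>2)
    = P + r + (2 * (m * t) * q) / 2 + w\<^sup>2 / 2"
    using E E2 by argo
  moreover have "\<bar>P + r + (2 * (m * t) * q) / 2 + w\<^sup>2 / 2\<bar>
      \<le> exp 42 * 42 ^ 3 * \<tau>\<^sup>2 + 99 * \<tau>\<^sup>2 + 108 * \<tau>\<^sup>2 + 1521 / 2 * \<tau>\<^sup>2"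
    using P r2 q2 w2 unfolding abs_le_iff by linarith
  ultimately show "\<bar>exp E - (1 + m * t + m * (p - 1) / 2 * t\<^sup>2 - c * t + m\<^sup>2 * t\<^sup>2 / 2 - c * m * t\<^sup>2)\<bar>
       \<le> (968 + exp 42 * 42 ^ 3) * \<tau>\<^sup>2"
    unfolding distrib_right using zero_le_power2[of \<tau>] by linarith
qed

lemma radial_ratio:
  assumes s: "0 < s" and t: "0 < 1 + t"
  shows "radial p c (s * (1 + t)) / radial p c s =
    exp (s powr p * (((1 + t) powr p - 1) / p) - c * ln (1 + t))"
proof -
  have "radial p c (s * (1 + t)) / radial p c s =
      exp (s powr p * (1 + t) powr p / p) / exp (s powr p / p) * (1 + t) powr (- c)"
    using assms by (simp add: radial_def powr_mult)
  also have "(1 + t) powr (- c) = exp (- c * ln (1 + t))" using t by (simp add: powr_def)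
  also have "exp (s powr p * (1 + t) powr p / p) / exp (s powr p / p) * exp (- c * ln (1 + t)) =
     exp (s powr p * (((1 + t) powr p - 1) / p) - c * ln (1 + t))"
    by (simp add: exp_diff[symmetric] exp_add[symmetric] diff_divide_distrib algebra_simps)
  finally show ?thesis .
qed

definition radial_const :: real where "radial_const = 968 + exp 42 * 42 ^ 3"

text \<open>A second-order expansion in the increment \<open>h\<close>, whose range covers the steps
  to lattice neighbours. The coefficients are the logarithmic derivative and half the relative
  second derivative, the latter without its term of order \<open>1 / s\<^sup>2\<close>. The cruder
  first bound controls the overshoot at a boundary.\<close>

lemma radial_expansion:
  fixes p c s h :: real
  assumes p: "0 < p" "p \<le> 1 / 6" and c: "0 \<le> c" "c \<le> 1" and s: "36 \<le> s" and h: "\<bar>h\<bar> \<le> 3 * sqrt s"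
  defines "u \<equiv> s powr (p - 1)"
  shows "radial p c (s + h) \<le> exp 42 * radial p c s"
    and "\<bar>radial p c (s + h) / radial p c s - (1 + (u - c / s) * h +
       ((p - 1) / 2 * u / s + u\<^sup>2 / 2 - c * u / s) * h\<^sup>2)\<bar> \<le> radial_const / s"
proof -
  define t where "t = h / s"
  define \<tau> where "\<tau> = 1 / sqrt s"
  define m where "m = s powr p"
  have sq: "sqrt s * sqrt s = s" "6 \<le> sqrt s"
    using s real_le_rsqrt[of 6 s] by (auto simp: power2_eq_square)
  have \<tau>: "0 < \<tau>" "\<tau> \<le> 1 / 6" and \<tau>2: "\<tau>\<^sup>2 = 1 / s"
    using s sq unfolding \<tau>_def by (auto simp: power_divide field_simps)
  have sh: "s + h = s * (1 + t)" using s by (simp add: t_def field_simps)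
  have t: "\<bar>t\<bar> \<le> 3 * \<tau>"
  proof -
    have "\<bar>t\<bar> = \<bar>h\<bar> / s" unfolding t_def using s by simp
    also have "\<dots> \<le> 3 * sqrt s / s" using h s by (intro divide_right_mono) auto
    also have "\<dots> = 3 * \<tau>" using sq s unfolding \<tau>_def by (simp add: field_simps)
    finally show ?thesis .
  qed
  have th: "\<bar>t\<bar> \<le> 1 / 2" using t \<tau> by linarith
  have m1: "1 \<le> m" unfolding m_def using s p by (intro ge_one_powr_ge_zero) auto
  \<comment> \<open>Here \<open>p \<le> 1 / 6\<close> enters: it is what makes the cubic term of the
    exponential as small as \<open>1 / s\<close>.\<close>
  have "m ^ 3 = s powr (3 * p)" unfolding m_def using s by (simp add: powr_power mult.commute)
  also have "\<dots> \<le> s powr (1 / 2)" using p s by (intro powr_mono) auto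
  also have "\<dots> = sqrt s" using s by (simp add: powr_half_sqrt)
  finally have m3: "m ^ 3 * \<tau> \<le> 1" unfolding \<tau>_def using s by (simp add: field_simps)
  define E where "E = m * (((1 + t) powr p - 1) / p) - c * ln (1 + t)"
  define r where "r = E - (m * t + m * (p - 1) / 2 * t\<^sup>2 - c * t)"
  have Er: "E = m * t + m * (p - 1) / 2 * t\<^sup>2 - c * t + r" unfolding r_def by simp
  have "r = m * (((1 + t) powr p - 1) / p - (t + (p - 1) / 2 * t\<^sup>2)) - c * (ln (1 + t) - t)"
    unfolding r_def E_def by (simp add: algebra_simps)
  also have "\<bar>\<dots>\<bar> \<le> m * \<bar>((1 + t) powr p - 1) / p - (t + (p - 1) / 2 * t\<^sup>2)\<bar> + c * \<bar>ln (1 + t) - t\<bar>"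
    using m1 c by (intro order.trans[OF abs_triangle_ineq4]) (simp add: abs_mult)
  also have "\<dots> \<le> m * (3 * \<bar>t\<bar> ^ 3) + 1 * (2 * t\<^sup>2)"
    using m1 c p th by (intro add_mono mult_mono abs_binomial_remainder abs_ln_one_plus_x_minus_x_bound) auto
  finally have r: "\<bar>r\<bar> \<le> 3 * m * \<bar>t\<bar> ^ 3 + 2 * t\<^sup>2" by (simp add: mult_ac)
  note ex = exponent_expansion[OF m1 t \<tau> m3 p(1) _ c Er r]
  have ratio: "radial p c (s + h) / radial p c s = exp E"
    unfolding sh E_def m_def using s th by (intro radial_ratio) auto
  have um: "u = m / s" unfolding u_def m_def using s by (simp add: powr_diff)
  have poly: "1 + (u - c / s) * h + ((p - 1) / 2 * u / s + u\<^sup>2 / 2 - c * u / s) * h\<^sup>2 =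
     1 + m * t + m * (p - 1) / 2 * t\<^sup>2 - c * t + m\<^sup>2 * t\<^sup>2 / 2 - c * m * t\<^sup>2"
    using s unfolding um t_def by (simp add: field_simps power2_eq_square)
  show "radial p c (s + h) \<le> exp 42 * radial p c s"
  proof -
    have "radial p c (s + h) / radial p c s \<le> exp 42" unfolding ratio using ex(1) p by simp
    then show ?thesis using radial_pos[of s p c] s by (simp add: field_simps)
  qed
  show "\<bar>radial p c (s + h) / radial p c s - (1 + (u - c / s) * h +
       ((p - 1) / 2 * u / s + u\<^sup>2 / 2 - c * u / s) * h\<^sup>2)\<bar> \<le> radial_const / s"
    using ex(2) p unfolding poly ratio radial_const_def \<tau>2 by simp
qed

section \<open>The averaging operator on radial and first-harmonic profiles\<close>

text \<open>The four increments of \<open>s\<close> have mean 1 and mean square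
  \<open>2 * s + 1\<close>. The quadratic term therefore produces \<open>s * u\<^sup>2 = k\<close>,
  which offsets the killing, and what is left at order \<open>u\<close> is
  \<open>(p - 2 * c) * u\<close>. In the difference of the two horizontal neighbours only the odd
  part survives, with leading term \<open>x * u\<close>.\<close>

lemma radial_average:
  fixes p c s x y :: real
  assumes p: "0 < p" "p \<le> 1 / 6" and c: "0 \<le> c" "c \<le> 1" and s: "36 \<le> s" and xy: "x\<^sup>2 + y\<^sup>2 = s"
  defines "u \<equiv> s powr (p - 1)" and "k \<equiv> s powr (2 * p - 1)" and "R \<equiv> \<lambda>h. radial p c (s + h) / radial p c s"
  shows "\<bar>(1 - k) / 4 * (R (2 * x + 1) + R (- 2 * x + 1) + R (2 * y + 1) + R (- 2 * y + 1))
       - (1 + (p - 2 * c) * u)\<bar> \<le> (radial_const + 6) / s"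
    and "\<bar>(1 - k) / 4 * (R (2 * x + 1) - R (- 2 * x + 1)) - x * u\<bar> \<le> (radial_const + 6) / sqrt s"
proof -
  define A where "A = u - c / s"
  define B where "B = (p - 1) / 2 * u / s + u\<^sup>2 / 2 - c * u / s"
  have s0: "0 < s" using s by simp
  have xs: "\<bar>x\<bar> \<le> sqrt s" "\<bar>y\<bar> \<le> sqrt s"
    using xy real_sqrt_le_mono[of "x\<^sup>2" s] real_sqrt_le_mono[of "y\<^sup>2" s] zero_le_power2[of x] zero_le_power2[of y]
    by auto
  have s6: "6 \<le> sqrt s" using s real_le_rsqrt[of 6 s] by auto
  have u: "0 < u" "u \<le> 1" unfolding u_def using s p powr_mono[of "p - 1" 0 s] by auto
  have us: "u\<^sup>2 * s = k"
  proof -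
    have "u\<^sup>2 * s = s powr (2 * (p - 1)) * s powr 1"
      unfolding u_def using s by (simp add: powr_power)
    also have "\<dots> = k" unfolding k_def powr_add[symmetric] by (simp add: algebra_simps)
    finally show ?thesis .
  qed
  have inv: "s powr (- 1) = 1 / s" using s by (simp add: powr_minus_divide)
  have k: "0 < k" "k \<le> 1" unfolding k_def using s p powr_mono[of "2 * p - 1" 0 s] by auto
  have k2: "k\<^sup>2 \<le> 1 / s"
  proof -
    have "k\<^sup>2 = s powr (2 * (2 * p - 1))" unfolding k_def using s by (simp add: powr_power mult.commute)
    also have "\<dots> \<le> s powr (- 1)" using s p by (intro powr_mono) auto
    finally show ?thesis unfolding inv .
  qed
  have ku: "k * u \<le> 1 / s"
  proof -
    have "k * u = s powr (2 * p - 1 + (p - 1))" unfolding k_def u_def by (simp only: powr_add)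
    also have "\<dots> \<le> s powr (- 1)" using s p by (intro powr_mono) auto
    finally show ?thesis unfolding inv .
  qed
  have u2: "u\<^sup>2 \<le> 1 / s" using us k s by (simp add: field_simps)
  have uds: "u / s \<le> 1 / s" using u s by (simp add: divide_right_mono)
  have B: "\<bar>B\<bar> \<le> 2 * (1 / s)"
  proof -
    have 1: "\<bar>(p - 1) / 2 * u / s\<bar> = (1 - p) / 2 * (u / s)" using p u s0 by (simp add: abs_mult)
    also have "\<dots> \<le> 1 / 2 * (1 / s)" using uds p u s0 by (intro mult_mono) auto
    finally have 1: "\<bar>(p - 1) / 2 * u / s\<bar> \<le> 1 / 2 * (1 / s)" .
    have "c * u / s \<le> 1 * (1 / s)" using mult_mono[of c 1 "u / s" "1 / s"] uds c u s0 by simp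
    moreover have "0 \<le> c * u / s" using c u s0 by simp
    ultimately show ?thesis unfolding B_def using 1 u2 zero_le_power2[of u] by linarith
  qed
  define P where "P = (\<lambda>h. 1 + A * h + B * h\<^sup>2)"
  have R: "\<bar>R h - P h\<bar> \<le> radial_const / s" if "\<bar>h\<bar> \<le> 3 * sqrt s" for h
    using radial_expansion(2)[OF p c s that] unfolding R_def P_def A_def B_def u_def by simp
  have R4: "\<bar>R (2 * x + 1) - P (2 * x + 1)\<bar> \<le> radial_const / s"
      "\<bar>R (- 2 * x + 1) - P (- 2 * x + 1)\<bar> \<le> radial_const / s"
      "\<bar>R (2 * y + 1) - P (2 * y + 1)\<bar> \<le> radial_const / s"
      "\<bar>R (- 2 * y + 1) - P (- 2 * y + 1)\<bar> \<le> radial_const / s"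
    using xs s6 by (intro R; linarith)+
  define e where "e = (R (2 * x + 1) + R (- 2 * x + 1) + R (2 * y + 1) + R (- 2 * y + 1)) / 4 -
    (1 + k + (p - 2 * c) * u)"
  have cs: "0 \<le> c / s" "c / s \<le> 1 / s" using c s0 by (auto intro: divide_right_mono)
  have "(P (2 * x + 1) + P (- 2 * x + 1)
      + P (2 * y + 1) + P (- 2 * y + 1)) / 4
     = 1 + A + B * (2 * (x\<^sup>2 + y\<^sup>2) + 1)"
    unfolding P_def by (simp add: power2_eq_square algebra_simps add_divide_distrib)
  also have "\<dots> = 1 + k + (p - 2 * c) * u - c / s + B"
  proof -
    have "B * (2 * s) = (p - 1) * u + k - 2 * c * u"
      unfolding B_def us[symmetric] using s0 by (simp add: field_simps power2_eq_square)
    then show ?thesis unfolding xy A_def by (simp add: algebra_simps)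
  qed
  finally have avg: "(P (2 * x + 1) + P (- 2 * x + 1)
      + P (2 * y + 1) + P (- 2 * y + 1)) / 4
     = 1 + k + (p - 2 * c) * u - c / s + B" .
  have e: "\<bar>e\<bar> \<le> radial_const / s + 3 * (1 / s)"
    unfolding e_def using R4 avg B cs unfolding abs_le_iff add_divide_distrib by (intro conjI; linarith)
  \<comment> \<open>Multiplying by \<open>1 - k\<close> cancels \<open>k\<close> up to
    \<open>k\<^sup>2\<close> and \<open>k * u\<close>, both at most \<open>1 / s\<close>.\<close>
  have "(1 - k) / 4 * (R (2 * x + 1) + R (- 2 * x + 1) + R (2 * y + 1) + R (- 2 * y + 1))
      = (1 - k) * (1 + k + (p - 2 * c) * u + e)"
    unfolding e_def by simp
  also have "\<dots> = (1 + (p - 2 * c) * u) + ((1 - k) * e - k\<^sup>2 - (p - 2 * c) * (k * u))"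
    by (simp add: algebra_simps power2_eq_square)
  finally have eq: "(1 - k) / 4 * (R (2 * x + 1) + R (- 2 * x + 1) + R (2 * y + 1) + R (- 2 * y + 1))
     - (1 + (p - 2 * c) * u) = (1 - k) * e - k\<^sup>2 - (p - 2 * c) * (k * u)" by linarith
  have "\<bar>(1 - k) * e\<bar> \<le> 1 * \<bar>e\<bar>" unfolding abs_mult using k by (intro mult_right_mono) auto
  moreover have "\<bar>(p - 2 * c) * (k * u)\<bar> \<le> 2 * (1 / s)"
    unfolding abs_mult[of "p - 2 * c"] using p c ku k u by (intro mult_mono) auto
  ultimately have "\<bar>(1 - k) * e - k\<^sup>2 - (p - 2 * c) * (k * u)\<bar> \<le> radial_const / s + 6 * (1 / s)"
    using e k2 zero_le_power2[of k] by linarith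
  then show "\<bar>(1 - k) / 4 * (R (2 * x + 1) + R (- 2 * x + 1) + R (2 * y + 1) + R (- 2 * y + 1))
       - (1 + (p - 2 * c) * u)\<bar> \<le> (radial_const + 6) / s"
    unfolding eq by (simp add: add_divide_distrib)
  define f where "f = (R (2 * x + 1) - R (- 2 * x + 1)) / 4 - x * u"
  have rc: "0 \<le> radial_const" by (simp add: radial_const_def)
  have si: "1 / s \<le> 1 / sqrt s" "\<bar>x\<bar> * (1 / s) \<le> 1 / sqrt s"
  proof -
    have "sqrt s * (1 / s) = 1 / sqrt s" using s0 by (simp add: field_simps)
    moreover have "\<bar>x\<bar> * (1 / s) \<le> sqrt s * (1 / s)" "1 * (1 / s) \<le> sqrt s * (1 / s)"
      using xs s6 s by (auto intro!: mult_right_mono divide_right_mono)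
    ultimately show "1 / s \<le> 1 / sqrt s" "\<bar>x\<bar> * (1 / s) \<le> 1 / sqrt s" by simp_all
  qed
  have diff: "P (2 * x + 1) - P (- 2 * x + 1)
      = 4 * (x * u) - 4 * (x * (c / s)) + 8 * (x * B)"
    unfolding P_def A_def by (simp add: power2_eq_square algebra_simps)
  have xc: "\<bar>x * (c / s)\<bar> \<le> 1 / sqrt s"
  proof -
    have "\<bar>x * (c / s)\<bar> \<le> \<bar>x\<bar> * (1 / s)"
      unfolding abs_mult using cs by (intro mult_left_mono) auto
    then show ?thesis using si by linarith
  qed
  have xB: "\<bar>x * B\<bar> \<le> 2 * (1 / sqrt s)"
  proof -
    have "\<bar>x * B\<bar> \<le> \<bar>x\<bar> * (2 * (1 / s))" unfolding abs_mult using B by (intro mult_left_mono) auto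
    also have "\<dots> = 2 * (\<bar>x\<bar> * (1 / s))" by simp
    also have "\<dots> \<le> 2 * (1 / sqrt s)" using si(2) by (intro mult_left_mono) auto
    finally show ?thesis .
  qed
  have rcs: "radial_const / s \<le> radial_const / sqrt s"
    using mult_left_mono[OF si(1) rc] by simp
  have f: "\<bar>f\<bar> \<le> radial_const / sqrt s + 5 * (1 / sqrt s)"
    unfolding f_def using R4(1,2) diff xc xB rcs rc unfolding abs_le_iff diff_divide_distrib by (intro conjI; linarith)
  have "(1 - k) / 4 * (R (2 * x + 1) - R (- 2 * x + 1)) - x * u = (1 - k) * f - x * (k * u)"
    unfolding f_def by (simp add: field_simps)
  moreover have "\<bar>(1 - k) * f\<bar> \<le> 1 * \<bar>f\<bar>" unfolding abs_mult using k by (intro mult_right_mono) auto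
  moreover have "\<bar>x * (k * u)\<bar> \<le> 1 / sqrt s"
  proof -
    have "\<bar>x * (k * u)\<bar> \<le> \<bar>x\<bar> * (1 / s)"
      unfolding abs_mult[of x] using ku k u by (intro mult_left_mono) auto
    then show ?thesis using si by linarith
  qed
  ultimately show "\<bar>(1 - k) / 4 * (R (2 * x + 1) - R (- 2 * x + 1)) - x * u\<bar> \<le> (radial_const + 6) / sqrt s"
    using f unfolding add_divide_distrib by linarith
qed

section \<open>The profiles at lattice sites\<close>

definition site_sq :: "site \<Rightarrow> real" where
  "site_sq z = (real_of_int (fst z))\<^sup>2 + (real_of_int (snd z))\<^sup>2"

lemma site_sq_neighbours:
  "site_sq (a + 1, b) = site_sq (a, b) + (2 * real_of_int a + 1)"
  "site_sq (a - 1, b) = site_sq (a, b) + (- 2 * real_of_int a + 1)"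
  "site_sq (a, b + 1) = site_sq (a, b) + (2 * real_of_int b + 1)"
  "site_sq (a, b - 1) = site_sq (a, b) + (- 2 * real_of_int b + 1)"
  by (simp_all add: site_sq_def power2_eq_square algebra_simps)

lemma kill_eq_powr:
  assumes "1 \<le> site_sq z" "0 < \<alpha>"
  shows "kill \<alpha> z = site_sq z powr (- \<alpha> / 2)"
proof -
  have z: "z \<noteq> (0, 0)" using assms(1) by (auto simp: site_sq_def)
  have n: "znorm z = site_sq z powr (1 / 2)"
    by (simp add: znorm_eq site_sq_def powr_half_sqrt)
  have "znorm z powr (- \<alpha>) = site_sq z powr (- \<alpha> / 2)"
    unfolding n powr_powr by simp
  moreover have "site_sq z powr (- \<alpha> / 2) \<le> 1"
    using assms powr_mono[of "- \<alpha> / 2" 0 "site_sq z"] by simp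
  ultimately show ?thesis using z by (simp add: kill_def)
qed

lemma kill_pos: "0 < kill \<alpha> z"
proof (cases "z = (0, 0)")
  case False
  then have "0 < znorm z"
    by (cases z) (auto simp: znorm_def zero_prod_def)
  then show ?thesis using False by (simp add: kill_def)
qed (simp add: kill_def)

text \<open>The second estimate is a discrete product rule: the horizontal neighbours carry
  \<open>x + 1\<close> and \<open>x - 1\<close> in place of \<open>x\<close>, which adds the
  difference term \<open>T\<close> and so one more \<open>s powr (p - 1)\<close>. Its error is
  larger by a factor of order \<open>sqrt s\<close> because
  \<open>\<bar>x\<bar> \<le> sqrt s\<close>.\<close>

lemma krw_avg_radial:
  fixes p c \<alpha> :: real and z :: site
  assumes p: "0 < p" "p \<le> 1 / 6" and c: "0 \<le> c" "c \<le> 1" and \<alpha>: "\<alpha> = 2 - 4 * p" and s: "36 \<le> site_sq z"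
  defines "s \<equiv> site_sq z"
  shows "\<bar>krw_avg (kill \<alpha>) (\<lambda>z. radial p c (site_sq z)) z - radial p c s * (1 + (p - 2 * c) * s powr (p - 1))\<bar>
       \<le> (radial_const + 6) / s * radial p c s"
    and "\<bar>krw_avg (kill \<alpha>) (\<lambda>z. real_of_int (fst z) * radial p c (site_sq z)) z
         - real_of_int (fst z) * radial p c s * (1 + (p - 2 * c + 1) * s powr (p - 1))\<bar>
       \<le> 2 * (radial_const + 6) / sqrt s * radial p c s"
proof -
  obtain a b where z: "z = (a, b)" by (cases z)
  define x y where "x = real_of_int a" and "y = real_of_int b"
  have x: "real_of_int (fst z) = x" by (simp add: z x_def)
  have xy: "x\<^sup>2 + y\<^sup>2 = s" unfolding s_def z site_sq_def x_def y_def by simp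
  have s36: "36 \<le> s" using s unfolding s_def .
  have k: "kill \<alpha> (a, b) = s powr (2 * p - 1)"
  proof -
    have "- \<alpha> / 2 = 2 * p - 1" unfolding \<alpha> by simp
    then show ?thesis using kill_eq_powr[of z \<alpha>] s36 p unfolding s_def z by (simp only: \<alpha>)
  qed
  define F where "F = radial p c s"
  have F: "0 < F" unfolding F_def using s36 by (intro radial_pos) auto
  define R where "R = (\<lambda>h. radial p c (s + h) / radial p c s)"
  have RF: "radial p c (s + h) = F * R h" for h unfolding R_def using F F_def by simp
  define u where "u = s powr (p - 1)"
  define k' where "k' = s powr (2 * p - 1)"
  define S where "S = (1 - k') / 4 * (R (2 * x + 1) + R (- 2 * x + 1) + R (2 * y + 1) + R (- 2 * y + 1))"
  define T where "T = (1 - k') / 4 * (R (2 * x + 1) - R (- 2 * x + 1))"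
  have av: "\<bar>S - (1 + (p - 2 * c) * u)\<bar> \<le> (radial_const + 6) / s" "\<bar>T - x * u\<bar> \<le> (radial_const + 6) / sqrt s"
    unfolding S_def T_def R_def u_def k'_def by (rule radial_average[OF p c s36 xy])+
  have Q1: "krw_avg (kill \<alpha>) (\<lambda>z. radial p c (site_sq z)) z = F * S"
    unfolding z krw_avg_eq k S_def site_sq_neighbours s_def[unfolded z, symmetric] x_def[symmetric] y_def[symmetric] RF k'_def
    by (simp add: algebra_simps)
  have Q2: "krw_avg (kill \<alpha>) (\<lambda>z. real_of_int (fst z) * radial p c (site_sq z)) z = F * (x * S + T)"
    unfolding z krw_avg_eq k S_def T_def site_sq_neighbours s_def[unfolded z, symmetric] fst_conv
      of_int_add of_int_diff of_int_1 x_def[symmetric] y_def[symmetric] RF k'_def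
    by (simp add: algebra_simps add_divide_distrib diff_divide_distrib)
  have "\<bar>F * S - F * (1 + (p - 2 * c) * u)\<bar> = F * \<bar>S - (1 + (p - 2 * c) * u)\<bar>"
    using F by (simp add: right_diff_distrib[symmetric] abs_mult)
  also have "\<dots> \<le> F * ((radial_const + 6) / s)" using av(1) F by (intro mult_left_mono) auto
  finally show "\<bar>krw_avg (kill \<alpha>) (\<lambda>z. radial p c (site_sq z)) z - radial p c s * (1 + (p - 2 * c) * s powr (p - 1))\<bar>
       \<le> (radial_const + 6) / s * radial p c s"
    unfolding Q1 F_def[symmetric] u_def by (simp add: mult.commute)
  define C where "C = radial_const + 6"
  have C: "0 \<le> C" by (simp add: C_def radial_const_def)
  have "\<bar>x\<bar> \<le> sqrt s" using xy real_sqrt_le_mono[of "x\<^sup>2" s] zero_le_power2[of y] by auto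
  then have "\<bar>x\<bar> * (C / s) \<le> sqrt s * (C / s)" using C s36 by (intro mult_right_mono) auto
  also have "\<dots> = C / sqrt s" using s36 by (simp add: field_simps)
  finally have xC: "\<bar>x\<bar> * (C / s) \<le> C / sqrt s" .
  have "\<bar>x * (S - (1 + (p - 2 * c) * u))\<bar> \<le> \<bar>x\<bar> * (C / s)"
    unfolding abs_mult using av(1) by (intro mult_left_mono) (auto simp: C_def)
  then have b: "\<bar>x * (S - (1 + (p - 2 * c) * u)) + (T - x * u)\<bar> \<le> 2 * C / sqrt s"
    using av(2) xC unfolding C_def[symmetric] by linarith
  have "F * (x * S + T) - x * F * (1 + (p - 2 * c + 1) * u) =
      F * (x * (S - (1 + (p - 2 * c) * u)) + (T - x * u))"
    by (simp add: algebra_simps)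
  then have "\<bar>F * (x * S + T) - x * F * (1 + (p - 2 * c + 1) * u)\<bar> =
      F * \<bar>x * (S - (1 + (p - 2 * c) * u)) + (T - x * u)\<bar>"
    using F by (simp add: abs_mult)
  also have "\<dots> \<le> F * (2 * C / sqrt s)" using b F by (intro mult_left_mono) auto
  finally have "\<bar>F * (x * S + T) - x * F * (1 + (p - 2 * c + 1) * u)\<bar> \<le> 2 * C / sqrt s * F"
    by (simp add: mult.commute)
  then show "\<bar>krw_avg (kill \<alpha>) (\<lambda>z. real_of_int (fst z) * radial p c (site_sq z)) z
         - real_of_int (fst z) * radial p c s * (1 + (p - 2 * c + 1) * s powr (p - 1))\<bar>
       \<le> 2 * (radial_const + 6) / sqrt s * radial p c s"
    unfolding Q2 F_def[symmetric] u_def C_def x .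
qed

section \<open>Barriers\<close>

lemma radial_add: "0 < s \<Longrightarrow> radial p (c + e) s = s powr (- e) * radial p c s"
  unfolding radial_def using powr_add[of s "- e" "- c"] by (simp add: add.commute)

text \<open>The logarithmic derivative \<open>s powr (p - 1) - c / s\<close> is nonnegative for
  \<open>s \<ge> 1\<close>. This is integrated by hand in the variable \<open>ln s\<close>, using
  \<open>exp (p * v) \<ge> 1 + p * v\<close>.\<close>

lemma radial_mono:
  assumes p: "0 < p" and c: "c \<le> 1" and r: "1 \<le> r" "r \<le> s"
  shows "radial p c r \<le> radial p c s"
proof -
  define v where "v = ln s - ln r"
  have v: "0 \<le> v" unfolding v_def using r by simp
  have eq: "radial p c w = exp (exp (p * ln w) / p - c * ln w)" if "1 \<le> w" for w
    using that unfolding radial_def by (simp add: powr_def exp_diff exp_minus field_simps)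
  have "p * v \<le> exp (p * v) - 1" using exp_ge_add_one_self[of "p * v"] by linarith
  then have "exp (p * ln r) * (p * v) \<le> exp (p * ln r) * (exp (p * v) - 1)"
    by (intro mult_left_mono) auto
  also have "\<dots> = exp (p * ln s) - exp (p * ln r)"
    unfolding v_def by (simp add: right_diff_distrib exp_diff)
  finally have 1: "exp (p * ln r) * (p * v) \<le> exp (p * ln s) - exp (p * ln r)" .
  have "1 * (p * v) \<le> exp (p * ln r) * (p * v)"
    using r p v by (intro mult_right_mono) auto
  with 1 have "p * v \<le> exp (p * ln s) - exp (p * ln r)" by linarith
  then have "v \<le> (exp (p * ln s) - exp (p * ln r)) / p" using p by (simp add: field_simps)
  moreover have "c * v \<le> 1 * v" using c v by (intro mult_right_mono) auto
  ultimately have "exp (p * ln r) / p - c * ln r \<le> exp (p * ln s) / p - c * ln s"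
    unfolding v_def by (simp add: diff_divide_distrib algebra_simps)
  then show ?thesis using eq r by simp
qed

text \<open>A crude bound from \<open>exp v \<ge> v\<^sup>2 / 2\<close>; it lets the correction
  profile exceed any given constant.\<close>

lemma radial_ge_powr:
  assumes "0 < p" "1 \<le> s"
  shows "s powr p / (2 * p\<^sup>2) \<le> radial p p s"
proof -
  define v where "v = s powr p / p"
  have v: "0 < v" using assms by (simp add: v_def)
  have "v\<^sup>2 / 2 \<le> exp v" using exp_lower_Taylor_quadratic[of v] v by linarith
  then have "v\<^sup>2 / 2 * s powr (- p) \<le> radial p p s"
    unfolding radial_def v_def[symmetric] by (intro mult_right_mono) auto
  moreover have "v\<^sup>2 / 2 * s powr (- p) = s powr p / (2 * p\<^sup>2)"
    using assms by (simp add: v_def powr_minus field_simps power2_eq_square)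
  ultimately show ?thesis by simp
qed

text \<open>With \<open>m = r powr p\<close>, passing from \<open>r\<close> to its square turns
  \<open>m\<close> into \<open>m\<^sup>2\<close>, so the profile grows by
  \<open>exp ((m * m - m) / p) * r powr (- (p / 2))\<close>. This is at least \<open>m / 2\<close>,
  which makes the outer radius of the lopsided disc negligible.\<close>

lemma radial_square_ge:
  assumes p: "0 < p" "p \<le> 1" and r: "1 \<le> r" and m: "2 \<le> r powr p"
  shows "r powr p * radial p (p / 2) r \<le> 2 * radial p (p / 2) (r\<^sup>2)"
proof -
  define m where "m = r powr p"
  have m2: "2 \<le> m" using assms(4) by (simp add: m_def)
  have sq: "(r\<^sup>2) powr q = r powr q * r powr q" for q
    using r by (simp add: power2_eq_square powr_mult)
  have half: "r powr (- (p / 2)) \<ge> 1 / m"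
  proof -
    have "r powr (- p) \<le> r powr (- (p / 2))" using r p by (intro powr_mono) auto
    then show ?thesis unfolding m_def by (simp add: powr_minus_divide)
  qed
  have "m \<le> m * (m - 1)" using mult_left_mono[of 1 "m - 1" m] m2 by simp
  also have "\<dots> \<le> (m * m - m) / p"
  proof -
    have "0 \<le> m * m - m" using mult_left_mono[of 1 "m" m] m2 by simp
    then have "(m * m - m) * p \<le> (m * m - m) * 1" using p by (intro mult_left_mono) auto
    then show ?thesis using p by (simp add: field_simps)
  qed
  finally have "exp m \<le> exp ((m * m - m) / p)" by simp
  moreover have "m\<^sup>2 / 2 \<le> exp m" using exp_lower_Taylor_quadratic[of m] m2 by linarith
  ultimately have "m\<^sup>2 / 2 \<le> exp ((m * m - m) / p)" by linarith
  then have "m\<^sup>2 / 2 * (1 / m) \<le> exp ((m * m - m) / p) * r powr (- (p / 2))"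
    using half m2 by (intro mult_mono) auto
  then have "m \<le> 2 * (exp ((m * m - m) / p) * r powr (- (p / 2)))"
    using m2 by (simp add: power2_eq_square)
  then have "m * radial p (p / 2) r \<le> 2 * (exp ((m * m - m) / p) * r powr (- (p / 2))) * radial p (p / 2) r"
    using r by (intro mult_right_mono) (auto simp: radial_def)
  also have "\<dots> = 2 * radial p (p / 2) (r\<^sup>2)"
    unfolding radial_def sq m_def[symmetric] by (simp add: diff_divide_distrib exp_diff)
  finally show ?thesis unfolding m_def .
qed

lemma finite_site_sq_less: "finite {z. site_sq z < r}"
proof -
  define n where "n = \<lceil>r\<rceil>"
  have le: "\<bar>i\<bar> \<le> i\<^sup>2" for i :: int
    using self_le_power[of "\<bar>i\<bar>" 2] by (cases "i = 0") auto
  have "{z. site_sq z < r} \<subseteq> {- n..n} \<times> {- n..n}"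
  proof (rule subrelI)
    fix i j assume "(i, j) \<in> {z. site_sq z < r}"
    then have "real_of_int (i\<^sup>2 + j\<^sup>2) < r" by (simp add: site_sq_def)
    then have "i\<^sup>2 + j\<^sup>2 \<le> n" unfolding n_def by linarith
    then have "\<bar>i\<bar> \<le> n" "\<bar>j\<bar> \<le> n" using le[of i] le[of j] zero_le_power2[of i] zero_le_power2[of j] by linarith+
    then show "(i, j) \<in> {- n..n} \<times> {- n..n}" by auto
  qed
  then show ?thesis by (rule finite_subset) simp
qed

section \<open>Sums of supersolutions and repair near the origin\<close>

lemma krw_avg_add_const: "krw_avg k (\<lambda>z. f z + K) z = krw_avg k f z + (1 - k z) * K"
  unfolding krw_avg_def by (simp add: sum.distrib card_neighbours field_simps)

lemma krw_avg_add: "krw_avg k (\<lambda>z. f z + g z) z = krw_avg k f z + krw_avg k g z"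
  by (simp add: krw_avg_def sum.distrib algebra_simps)

lemma krw_avg_cmult: "krw_avg k (\<lambda>z. c * f z) z = c * krw_avg k f z"
  by (simp add: krw_avg_def sum_distrib_left[symmetric])

text \<open>Adding \<open>K\<close> gains \<open>k z * K\<close> at every \<open>z\<close>, and only
  finitely many sites need repair. Every larger constant works too, so several barriers can share
  one.\<close>

lemma supersolution_add_const:
  assumes k: "\<And>z. 0 < k z" and super: "\<And>z. S \<le> site_sq z \<Longrightarrow> krw_avg k f z \<le> f z"
  shows "\<exists>K\<ge>0. \<forall>K'\<ge>K. \<forall>z. krw_avg k (\<lambda>z. f z + K') z \<le> f z + K'"
proof -
  let ?A = "{z. site_sq z < S}"
  define K where "K = (\<Sum>z\<in>?A. \<bar>krw_avg k f z - f z\<bar> / k z)"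
  have K0: "0 \<le> K" unfolding K_def using k by (intro sum_nonneg divide_nonneg_pos) auto
  have "krw_avg k (\<lambda>z. f z + K') z \<le> f z + K'" if K': "K \<le> K'" for K' z
  proof (cases "z \<in> ?A")
    case True
    have "\<bar>krw_avg k f z - f z\<bar> / k z \<le> K" unfolding K_def
      by (rule member_le_sum[OF True _ finite_site_sq_less]) (use k in \<open>auto intro!: divide_nonneg_pos\<close>)
    with K' have "\<bar>krw_avg k f z - f z\<bar> / k z \<le> K'" by linarith
    then have "\<bar>krw_avg k f z - f z\<bar> \<le> k z * K'" using k[of z] by (simp add: pos_divide_le_eq mult.commute)
    then show ?thesis unfolding krw_avg_add_const by (simp add: algebra_simps)
  next
    case False
    have "0 \<le> k z * K'" using k[of z] K0 K' by simp
    then show ?thesis unfolding krw_avg_add_const using super[of z] False by (simp add: algebra_simps)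
  qed
  with K0 show ?thesis by blast
qed

text \<open>The correction \<open>radial p p\<close> has the relative gain $p s^{p-1}$, hence dominates the error terms
  $O(1/s)$ of the two approximate solutions \<open>radial p (p/2)\<close> and \<open>x \<cdot> radial p (p/2 + 1/2)\<close>.\<close>

lemma barriers:
  fixes p \<alpha> :: real
  assumes p: "0 < p" "p \<le> 1 / 6" and \<alpha>: "\<alpha> = 2 - 4 * p"
  defines "F \<equiv> \<lambda>z. radial p (p / 2) (site_sq z)" and "F1 \<equiv> \<lambda>z. radial p p (site_sq z)"
    and "W \<equiv> \<lambda>z. real_of_int (fst z) * radial p (p / 2 + 1 / 2) (site_sq z)"
  shows "\<exists>S. \<forall>z. S \<le> site_sq z \<longrightarrow>
     krw_avg (kill \<alpha>) (\<lambda>z. F z + F1 z) z \<le> F z + F1 z \<and>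
     krw_avg (kill \<alpha>) (\<lambda>z. F z + F1 z + W z) z \<le> F z + F1 z + W z \<and>
     krw_avg (kill \<alpha>) (\<lambda>z. F1 z - W z) z \<le> F1 z - W z"
proof -
  define C where "C = radial_const + 6"
  have C: "0 < C" unfolding C_def radial_const_def by (intro add_pos_pos mult_pos_pos) auto
  \<comment> \<open>36 is the range of the expansions; the other entry is solved from
    \<open>4 * C \<le> p * s powr (p / 2)\<close>.\<close>
  define S where "S = max 36 ((4 * C / p) powr (2 / p))"
  have "krw_avg (kill \<alpha>) (\<lambda>z. F z + F1 z) z \<le> F z + F1 z \<and>
     krw_avg (kill \<alpha>) (\<lambda>z. F z + F1 z + W z) z \<le> F z + F1 z + W z \<and>
     krw_avg (kill \<alpha>) (\<lambda>z. F1 z - W z) z \<le> F1 z - W z" if z: "S \<le> site_sq z" for z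
  proof -
    define s where "s = site_sq z"
    have s: "36 \<le> s" and sS: "(4 * C / p) powr (2 / p) \<le> s" using z unfolding S_def s_def by auto
    have s36: "36 \<le> site_sq z" using s s_def by simp
    have Fp: "0 < F z" unfolding F_def using s36 by (intro radial_pos) auto
    have F1p: "0 < F1 z" unfolding F1_def using s36 by (intro radial_pos) auto
    have F1F: "F1 z = s powr (- (p / 2)) * F z"
      using radial_add[of s p "p / 2" "p / 2"] s unfolding F1_def F_def s_def by simp
    have W1: "radial p (p / 2 + 1 / 2) s = F z / sqrt s"
      using radial_add[of s p "p / 2" "1 / 2"] s unfolding F_def s_def[symmetric]
      by (simp add: powr_minus_divide powr_half_sqrt)
    have F1le: "F1 z \<le> F z"
    proof -
      have "s powr (- (p / 2)) \<le> 1" using s p powr_mono[of "- (p / 2)" 0 s] by simp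
      then show ?thesis unfolding F1F using Fp by simp
    qed
    have QF: "\<bar>krw_avg (kill \<alpha>) F z - F z\<bar> \<le> C / s * F z"
      using krw_avg_radial(1)[OF p _ _ \<alpha> s36, of "p / 2"] p unfolding F_def C_def s_def by simp
    have QF1: "\<bar>krw_avg (kill \<alpha>) F1 z - F1 z * (1 - p * s powr (p - 1))\<bar> \<le> C / s * F1 z"
      using krw_avg_radial(1)[OF p _ _ \<alpha> s36, of p] p unfolding F1_def C_def s_def by simp
    have QW: "\<bar>krw_avg (kill \<alpha>) W z - W z\<bar> \<le> 2 * C / sqrt s * radial p (p / 2 + 1 / 2) s"
      using krw_avg_radial(2)[OF p _ _ \<alpha> s36, of "p / 2 + 1 / 2"] p unfolding W_def C_def s_def by simp
    also have "\<dots> = 2 * (C / s * F z)" unfolding W1 using s by (simp add: field_simps)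
    finally have QW: "\<bar>krw_avg (kill \<alpha>) W z - W z\<bar> \<le> 2 * (C / s * F z)" .
    have "4 * C / p = ((4 * C / p) powr (2 / p)) powr (p / 2)"
      using C p by (simp add: powr_powr)
    also have "\<dots> \<le> s powr (p / 2)" using sS p by (intro powr_mono2) auto
    finally have gain: "4 * C \<le> p * s powr (p / 2)" using p by (simp add: field_simps)
    have "p * s powr (p - 1) * F1 z = p * s powr (p / 2) * (F z / s)"
    proof -
      have "s powr (p - 1) * s powr (- (p / 2)) = s powr (p / 2 - 1)"
        unfolding powr_add[symmetric] by (simp add: algebra_simps)
      also have "\<dots> = s powr (p / 2) / s" using s by (simp add: powr_diff)
      finally have "p * (s powr (p - 1) * s powr (- (p / 2))) * F z = p * (s powr (p / 2) / s) * F z" by simp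
      then show ?thesis unfolding F1F by (simp add: mult.assoc)
    qed
    moreover have "4 * C * (F z / s) \<le> p * s powr (p / 2) * (F z / s)"
      using gain Fp s by (intro mult_right_mono) auto
    \<comment> \<open>The budget in units of \<open>C / s * F z\<close>: the correction gains 4, its
      own error takes 1, \<open>F\<close> takes 1 and \<open>W\<close> takes 2.\<close>
    ultimately have g: "4 * (C / s * F z) \<le> p * s powr (p - 1) * F1 z" by simp
    have CF1: "C / s * F1 z \<le> C / s * F z" using F1le C s by (intro mult_left_mono) auto
    have CF: "0 \<le> C / s * F z" using C s Fp by simp
    have d: "krw_avg (kill \<alpha>) F1 z - F1 z \<le> - 3 * (C / s * F z)"
    proof -
      have "F1 z * (1 - p * s powr (p - 1)) = F1 z - p * s powr (p - 1) * F1 z"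
        by (simp add: algebra_simps)
      then show ?thesis using QF1 g CF1 by linarith
    qed
    show ?thesis
      unfolding krw_avg_add krw_avg_diff[OF kill_range] using d QF QW CF by linarith
  qed
  then show ?thesis by blast
qed

section \<open>Two exhaustions\<close>

definition disc :: "nat \<Rightarrow> site set" where
  "disc R = {z. site_sq z < real R}"

definition lopsided_disc :: "nat \<Rightarrow> site set" where
  "lopsided_disc R = {z. site_sq z < real R \<or> (fst z \<le> 0 \<and> site_sq z < (real R)\<^sup>2)}"

lemma real_le_square: "real R \<le> (real R)\<^sup>2"
proof (cases R)
  case (Suc n)
  then show ?thesis using self_le_power[of "real R" 2] by simp
qed simp

lemma exhaustion_disc: "exhaustion disc"
  unfolding exhaustion_def disc_def incseq_def
proof (intro conjI allI impI)
  show "\<exists>R. x \<in> {z. site_sq z < real R}" for x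
    using reals_Archimedean2[of "site_sq x"] by auto
qed (auto simp: finite_site_sq_less)

lemma exhaustion_lopsided_disc: "exhaustion lopsided_disc"
  unfolding exhaustion_def
proof (intro conjI allI)
  have "(real m)\<^sup>2 \<le> (real n)\<^sup>2" if "m \<le> n" for m n using that by (intro power_mono) auto
  then show "incseq lopsided_disc"
    unfolding incseq_def lopsided_disc_def by (auto intro: less_le_trans)
  show "finite (lopsided_disc R)" for R
  proof (rule finite_subset[OF _ finite_site_sq_less])
    show "lopsided_disc R \<subseteq> {z. site_sq z < (real R)\<^sup>2}"
      unfolding lopsided_disc_def using less_le_trans[OF _ real_le_square] by blast
  qed
  show "\<exists>R. x \<in> lopsided_disc R" for x
    using reals_Archimedean2[of "site_sq x"] unfolding lopsided_disc_def by auto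
qed

lemma exit_prob_disc_reflect: "exit_prob (kill \<alpha>) (disc R) (- a, b) = exit_prob (kill \<alpha>) (disc R) (a, b)"
proof (rule exit_prob_reflect)
  show "finite (disc R)" using exhaustion_disc unfolding exhaustion_def by blast
  show "kill \<alpha> (- a, b) = kill \<alpha> (a, b)" for a b by (simp add: kill_def znorm_eq)
  show "(- a, b) \<in> disc R \<longleftrightarrow> (a, b) \<in> disc R" for a b by (simp add: disc_def site_sq_def)
qed (rule kill_pos kill_range)+

lemma site_sq_adj_le:
  assumes "adj x y"
  shows "site_sq y \<le> site_sq x + 2 * sqrt (site_sq x) + 1"
proof -
  obtain a b where x: "x = (a, b)" by (cases x)
  have "\<bar>real_of_int a\<bar> \<le> sqrt (site_sq x)" "\<bar>real_of_int b\<bar> \<le> sqrt (site_sq x)"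
    by (auto intro!: real_le_rsqrt simp: x site_sq_def)
  moreover have "y \<in> {(a + 1, b), (a - 1, b), (a, b + 1), (a, b - 1)}"
    using assms unfolding x adj_iff .
  ultimately show ?thesis by (auto simp: site_sq_neighbours x)
qed

lemma fst_adj_le: "adj x y \<Longrightarrow> fst y \<le> fst x + 1"
  by (cases x; cases y) (auto simp: adj_iff)

lemma abs_fst_le: "\<bar>real_of_int (fst z)\<bar> \<le> sqrt (site_sq z)"
  by (auto intro!: real_le_rsqrt simp: site_sq_def)

lemma radial_order:
  assumes p: "0 < p" "p \<le> 1 / 6" and s: "1 \<le> s"
  shows "radial p (p / 2 + 1 / 2) s = radial p (p / 2) s / sqrt s"
    and "radial p p s = s powr (- (p / 2)) * radial p (p / 2) s"
    and "radial p (p / 2 + 1 / 2) s \<le> radial p p s"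
proof -
  show "radial p (p / 2 + 1 / 2) s = radial p (p / 2) s / sqrt s"
    using radial_add[of s p "p / 2" "1 / 2"] s by (simp add: powr_minus_divide powr_half_sqrt)
  show "radial p p s = s powr (- (p / 2)) * radial p (p / 2) s"
    using radial_add[of s p "p / 2" "p / 2"] s by simp
  show "radial p (p / 2 + 1 / 2) s \<le> radial p p s"
    unfolding radial_def using p s by (intro mult_left_mono powr_mono) auto
qed

text \<open>At its right boundary \<open>lopsided_disc R\<close> looks like \<open>disc R\<close>; at its left boundary the upper
  barrier \<open>G + w\<close> can be small, which a small multiple of \<open>G\<close> makes up for, since the radial
  profile is much larger at $R^2$ than at $R$.\<close>

lemma lower_barrier_off_lopsided_disc:
  assumes p: "0 < p" "p \<le> 1 / 6" and R: "36 \<le> R"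
    and x: "x \<in> lopsided_disc R" and xy: "adj x y" and y: "y \<notin> lopsided_disc R"
  shows "real_of_int (fst y) * radial p (p / 2 + 1 / 2) (site_sq y) - radial p p (site_sq y)
    \<le> exp 42 * radial p (p / 2) (real R)"
proof -
  define s where "s = site_sq y"
  have sR: "real R \<le> s" using y unfolding lopsided_disc_def s_def by auto
  then have s: "1 \<le> s" using R by linarith
  note ord = radial_order[OF p s]
  have F: "0 < radial p c w" if "1 \<le> w" for c w using that by (intro radial_pos) auto
  show ?thesis
  \<comment> \<open>A step raises the first coordinate by at most 1, so \<open>fst y \<ge> 2\<close>
    puts \<open>x\<close> in the open right half, hence in the small disc, and \<open>y\<close> only
    slightly beyond it. If \<open>fst y \<le> 1\<close>, the correction alone outweighs the linear
    term.\<close>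
  proof (cases "fst y \<le> 1")
    case True
    then have "real_of_int (fst y) * radial p (p / 2 + 1 / 2) s \<le> 1 * radial p (p / 2 + 1 / 2) s"
      using F[OF s] by (intro mult_right_mono) (auto simp: less_imp_le)
    moreover have "0 < exp 42 * radial p (p / 2) (real R)" using F[of "real R"] R by simp
    ultimately show ?thesis using ord(3) unfolding s_def[symmetric] by linarith
  next
    case False
    then have "fst x > 0" using fst_adj_le[OF xy] by simp
    then have xR: "site_sq x < real R" using x unfolding lopsided_disc_def by auto
    have "s \<le> site_sq x + 2 * sqrt (site_sq x) + 1" unfolding s_def by (rule site_sq_adj_le[OF xy])
    also have "\<dots> \<le> real R + 2 * sqrt (real R) + 1" using xR by (intro add_mono mult_left_mono) auto
    also have "\<dots> \<le> real R + 3 * sqrt (real R)" using R by simp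
    finally have h: "\<bar>s - real R\<bar> \<le> 3 * sqrt (real R)" using sR by linarith
    have "radial p (p / 2) (real R + (s - real R)) \<le> exp 42 * radial p (p / 2) (real R)"
      by (rule radial_expansion(1)[OF p]) (use p R h in auto)
    then have Fs: "radial p (p / 2) s \<le> exp 42 * radial p (p / 2) (real R)" by simp
    have "real_of_int (fst y) * radial p (p / 2 + 1 / 2) s \<le> sqrt s * radial p (p / 2 + 1 / 2) s"
      using abs_fst_le[of y] F[OF s] unfolding s_def[symmetric]
      by (intro mult_right_mono) (auto simp: less_imp_le)
    also have "\<dots> = radial p (p / 2) s" unfolding ord(1) using s by simp
    finally show ?thesis using Fs F[OF s, of p] unfolding s_def[symmetric] by linarith
  qed
qed

lemma upper_barrier_off_lopsided_disc:
  assumes p: "0 < p" "p \<le> 1 / 6" and R: "36 \<le> R" and y: "y \<notin> lopsided_disc R"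
  defines "G \<equiv> radial p (p / 2) (site_sq y) + radial p p (site_sq y)"
    and "w \<equiv> real_of_int (fst y) * radial p (p / 2 + 1 / 2) (site_sq y)"
  shows "radial p (p / 2) (real R) \<le>
     G + w + radial p (p / 2) (real R) / radial p (p / 2) ((real R)\<^sup>2) * G"
proof -
  define s where "s = site_sq y"
  define \<epsilon> where "\<epsilon> = radial p (p / 2) (real R) / radial p (p / 2) ((real R)\<^sup>2)"
  have sR: "real R \<le> s" using y unfolding lopsided_disc_def s_def by auto
  then have s: "1 \<le> s" using R by linarith
  note ord = radial_order[OF p s]
  have F: "0 < radial p c w" if "1 \<le> w" for c w using that by (intro radial_pos) auto
  have R1: "1 \<le> real R" "1 \<le> (real R)\<^sup>2" using R real_le_square[of R] by linarith+
  have \<epsilon>: "0 < \<epsilon>" unfolding \<epsilon>_def using F R1 by simp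
  have G: "radial p (p / 2) s < G" unfolding G_def s_def[symmetric] using F[OF s, of p] by simp
  show ?thesis
  proof (cases "fst y \<le> 0")
    case False
    then have "0 \<le> w" unfolding w_def s_def[symmetric] using F[OF s] by (simp add: less_imp_le)
    moreover have "radial p (p / 2) (real R) \<le> radial p (p / 2) s"
      using p R1 sR by (intro radial_mono) auto
    moreover have "0 \<le> \<epsilon> * G" using \<epsilon> G F[OF s, of "p / 2"] by simp
    ultimately show ?thesis using G unfolding \<epsilon>_def[symmetric] by linarith
  next
    case True
    then have s2: "(real R)\<^sup>2 \<le> s" using y unfolding lopsided_disc_def s_def by auto
    \<comment> \<open>On the left \<open>w\<close> can be as low as minus the main profile, so
      \<open>G + w\<close> is only known to be nonnegative and the multiple of \<open>G\<close> has
      to supply the boundary value.\<close>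
    have "sqrt s * radial p (p / 2 + 1 / 2) s = radial p (p / 2) s" unfolding ord(1) using s by simp
    moreover have "- sqrt s * radial p (p / 2 + 1 / 2) s \<le> w"
      unfolding w_def s_def[symmetric] using abs_fst_le[of y] F[OF s] unfolding s_def[symmetric]
      by (intro mult_right_mono) (auto simp: less_imp_le)
    ultimately have "0 \<le> G + w" using G by simp
    moreover have "radial p (p / 2) (real R) \<le> \<epsilon> * G"
    proof -
      have "radial p (p / 2) ((real R)\<^sup>2) \<le> radial p (p / 2) s"
        using p R1 s2 by (intro radial_mono) auto
      then have "\<epsilon> * radial p (p / 2) ((real R)\<^sup>2) \<le> \<epsilon> * G" using \<epsilon> G by (intro mult_left_mono) auto
      then show ?thesis unfolding \<epsilon>_def using F[OF R1(2), of "p / 2"] by simp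
    qed
    ultimately show ?thesis unfolding \<epsilon>_def[symmetric] by linarith
  qed
qed

lemma eventually_le_powr:
  fixes Z q :: real
  assumes "0 < q"
  shows "\<forall>\<^sub>F n in sequentially. Z \<le> real n powr q"
proof -
  have "\<forall>\<^sub>F n in sequentially. max Z 1 powr (1 / q) \<le> real n"
    using filterlim_real_sequentially unfolding filterlim_at_top by blast
  then show ?thesis
  proof eventually_elim
    case (elim n)
    have "max Z 1 = (max Z 1 powr (1 / q)) powr q" using assms by (simp add: powr_powr)
    also have "\<dots> \<le> real n powr q" using elim assms by (intro powr_mono2) auto
    finally show ?case by simp
  qed
qed

text \<open>Relative to the profile at \<open>s = R\<close>, the barriers give at least
  \<open>(F - F1 - K) / exp 42\<close> at the right site and at most \<open>F1 + K + 1\<close> at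
  the left one. Since \<open>F / F1 = s powr (p / 2)\<close> with \<open>s\<close> the square of
  \<open>a\<close>, the first dominates for large \<open>a\<close>. The choices are made in the
  order \<open>K\<close>, \<open>a\<close>, \<open>R\<close>.\<close>

lemma exit_ratio_lopsided_disc_ge_2:
  fixes p \<alpha> :: real
  assumes p: "0 < p" "p \<le> 1 / 6" and \<alpha>: "\<alpha> = 2 - 4 * p"
  obtains a :: nat where "1 < a"
    "\<forall>\<^sub>F R in sequentially. 2 * exit_prob (kill \<alpha>) (lopsided_disc R) (- int a, 0)
       \<le> exit_prob (kill \<alpha>) (lopsided_disc R) (int a, 0)"
proof -
  define F where "F = (\<lambda>z. radial p (p / 2) (site_sq z))"
  define F1 where "F1 = (\<lambda>z. radial p p (site_sq z))"
  define W where "W = (\<lambda>z. real_of_int (fst z) * radial p (p / 2 + 1 / 2) (site_sq z))"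
  let ?Q = "krw_avg (kill \<alpha>)"
  have "\<exists>S. \<forall>z. S \<le> site_sq z \<longrightarrow> ?Q (\<lambda>z. F z + F1 z) z \<le> F z + F1 z \<and>
      ?Q (\<lambda>z. F z + F1 z + W z) z \<le> F z + F1 z + W z \<and> ?Q (\<lambda>z. F1 z - W z) z \<le> F1 z - W z"
    unfolding F_def F1_def W_def by (rule barriers[OF p \<alpha>])
  then obtain S where S: "?Q (\<lambda>z. F z + F1 z) z \<le> F z + F1 z"
    "?Q (\<lambda>z. F z + F1 z + W z) z \<le> F z + F1 z + W z"
    "?Q (\<lambda>z. F1 z - W z) z \<le> F1 z - W z" if "S \<le> site_sq z" for z
    by auto
  obtain K1 where K1: "0 \<le> K1" "\<forall>K'\<ge>K1. \<forall>z. ?Q (\<lambda>z. F z + F1 z + K') z \<le> F z + F1 z + K'"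
    using supersolution_add_const[OF kill_pos S(1)] by blast
  obtain K2 where K2: "0 \<le> K2" "\<forall>K'\<ge>K2. \<forall>z. ?Q (\<lambda>z. F z + F1 z + W z + K') z \<le> F z + F1 z + W z + K'"
    using supersolution_add_const[OF kill_pos S(2)] by blast
  obtain K3 where K3: "0 \<le> K3" "\<forall>K'\<ge>K3. \<forall>z. ?Q (\<lambda>z. F1 z - W z + K') z \<le> F1 z - W z + K'"
    using supersolution_add_const[OF kill_pos S(3)] by blast
  define K where "K = K1 + K2 + K3"
  have K: "0 \<le> K" and Q1: "?Q (\<lambda>z. F z + F1 z + K) z \<le> F z + F1 z + K"
    and Q2: "?Q (\<lambda>z. F z + F1 z + W z + K) z \<le> F z + F1 z + W z + K"
    and Q3: "?Q (\<lambda>z. F1 z - W z + K) z \<le> F1 z - W z + K" for z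
    unfolding K_def using K1(1) K2(1) K3(1) by (auto intro!: K1(2)[rule_format] K2(2)[rule_format] K3(2)[rule_format])
  define B :: real where "B = exp 42"
  have B: "0 < B" by (simp add: B_def)
  \<comment> \<open>Solved from \<open>gap\<close> below: \<open>F1 \<ge> T\<close> and
    \<open>F \<ge> (2 * B + 2) * F1\<close> together imply it.\<close>
  define T where "T = K + 2 * B * (K + 1)"
  have sq: "(real a ^ 2) powr q = real a powr (2 * q)" for a q
    by (cases "a = 0") (simp_all add: powr_powr flip: powr_numeral)
  have "\<forall>\<^sub>F a in sequentially. 2 * B + 2 \<le> (real a ^ 2) powr (p / 2)"
      "\<forall>\<^sub>F a in sequentially. T * (2 * p\<^sup>2) \<le> (real a ^ 2) powr p"
    unfolding sq using p by (auto intro!: eventually_le_powr)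
  then have "\<forall>\<^sub>F a in sequentially. 2 * B + 2 \<le> (real a ^ 2) powr (p / 2) \<and>
      T * (2 * p\<^sup>2) \<le> (real a ^ 2) powr p \<and> 1 < a"
    by (intro eventually_conj eventually_gt_at_top)
  then obtain a :: nat where a: "2 * B + 2 \<le> (real a ^ 2) powr (p / 2)"
      "T * (2 * p\<^sup>2) \<le> (real a ^ 2) powr p" and a1: "1 < a"
    by (auto simp: eventually_sequentially)
  define s where "s = real a ^ 2"
  have s: "1 \<le> s" unfolding s_def using a1 by simp
  note ord = radial_order[OF p s]
  have F1T: "T \<le> radial p p s"
  proof -
    have "T \<le> s powr p / (2 * p\<^sup>2)" using a(2) p unfolding s_def by (simp add: pos_le_divide_eq)
    also have "\<dots> \<le> radial p p s" using p s by (intro radial_ge_powr) auto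
    finally show ?thesis .
  qed
  have FF1: "(2 * B + 2) * radial p p s \<le> radial p (p / 2) s"
  proof -
    have "(2 * B + 2) * radial p p s \<le> s powr (p / 2) * radial p p s"
      using a(1) a1 radial_pos[of s p p] unfolding s_def by (intro mult_right_mono) auto
    also have "\<dots> = radial p (p / 2) s"
      unfolding ord(2) using s by (simp add: powr_minus)
    finally show ?thesis .
  qed
  let ?x = "(int a, 0) :: site" and ?y = "(- int a, 0) :: site"
  have sx: "site_sq ?x = s" "site_sq ?y = s" by (simp_all add: site_sq_def s_def)
  have sa: "real a * radial p (p / 2 + 1 / 2) s = radial p (p / 2) s"
    unfolding ord(1) using a1 by (simp add: s_def)
  have gap: "2 * (B * (radial p p s + K + 1)) \<le> radial p (p / 2) s - radial p p s - K"
    using FF1 F1T unfolding T_def by (simp add: algebra_simps)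
  \<comment> \<open>\<open>R\<close> may depend on \<open>a\<close>. As
    \<open>radial_square_ge\<close> gives \<open>real R powr p * \<epsilon> \<le> 2\<close>, this
    size of \<open>R\<close> makes the \<epsilon> term at the left site at most 1.\<close>
  have "\<forall>\<^sub>F R in sequentially. max 2 (2 * (F ?y + F1 ?y + K)) \<le> real R powr p"
    by (rule eventually_le_powr[OF p(1)])
  then have "\<forall>\<^sub>F R in sequentially. max 2 (2 * (F ?y + F1 ?y + K)) \<le> real R powr p \<and> nat \<lceil>s\<rceil> + 36 < R"
    by (intro eventually_conj eventually_gt_at_top)
  then have "\<forall>\<^sub>F R in sequentially. 2 * exit_prob (kill \<alpha>) (lopsided_disc R) ?y
       \<le> exit_prob (kill \<alpha>) (lopsided_disc R) ?x"
  proof eventually_elim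
    case (elim R)
    then have R: "36 \<le> R" and sR: "s < real R" and m: "2 \<le> real R powr p"
      and m': "2 * (F ?y + F1 ?y + K) \<le> real R powr p" by linarith+
    define \<Phi> where "\<Phi> = radial p (p / 2) (real R)"
    define \<epsilon> where "\<epsilon> = \<Phi> / radial p (p / 2) ((real R)\<^sup>2)"
    have \<Phi>: "0 < \<Phi>" unfolding \<Phi>_def using R by (intro radial_pos) auto
    have \<Phi>2: "0 < radial p (p / 2) ((real R)\<^sup>2)" using R by (intro radial_pos) auto
    have \<epsilon>0: "0 < \<epsilon>" unfolding \<epsilon>_def using \<Phi> \<Phi>2 by simp
    have Gy: "0 \<le> F ?y + F1 ?y + K"
      using K radial_pos[of s p p] radial_pos[of s p "p / 2"] s unfolding F_def F1_def sx by simp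
    have "real R powr p * \<epsilon> \<le> 2"
      using radial_square_ge[of p "real R"] p R m \<Phi>2 unfolding \<epsilon>_def \<Phi>_def
      by (simp add: pos_divide_le_eq)
    moreover have "\<epsilon> * (2 * (F ?y + F1 ?y + K)) \<le> \<epsilon> * real R powr p"
      using m' \<epsilon>0 by (intro mult_left_mono) auto
    ultimately have \<epsilon>: "\<epsilon> * (F ?y + F1 ?y + K) \<le> 1" by argo
    let ?L = "lopsided_disc R"
    have fin: "finite ?L" using exhaustion_lopsided_disc unfolding exhaustion_def by blast
    have mem: "?x \<in> ?L" "?y \<in> ?L" using sR unfolding lopsided_disc_def by (simp_all add: sx)
    define D where "D = B * \<Phi>"
    have D: "0 < D" unfolding D_def using B \<Phi> by simp
    \<comment> \<open>The negative of the third supersolution is a subsolution; dividing by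
      \<open>D\<close>, the bound for \<open>W - F1\<close> off the domain, brings its boundary
      values below 1.\<close>
    have "(- 1 / D) * (F1 ?x - W ?x + K) \<le> exit_prob (kill \<alpha>) ?L ?x"
    proof (rule exit_prob_ge[OF kill_range fin kill_pos _ _ mem(1)])
      show "(- 1 / D) * (F1 z - W z + K) \<le> ?Q (\<lambda>z. (- 1 / D) * (F1 z - W z + K)) z" for z
        unfolding krw_avg_cmult using Q3[of z] D by (intro mult_left_mono_neg) auto
      fix z y assume "z \<in> ?L" "adj z y" "y \<notin> ?L"
      then have "W y - F1 y \<le> D"
        unfolding D_def W_def F1_def B_def \<Phi>_def by (intro lower_barrier_off_lopsided_disc p R)
      then show "(- 1 / D) * (F1 y - W y + K) \<le> 1" using D K by (simp add: pos_le_divide_eq)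
    qed
    then have lower: "(radial p (p / 2) s - radial p p s - K) / D \<le> exit_prob (kill \<alpha>) ?L ?x"
    proof -
      have "(- 1 / D) * (u - v + K) = (v - u - K) / D" for u v
        unfolding times_divide_eq_left by (rule arg_cong[where f = "\<lambda>t. t / D"]) simp
      moreover have "W ?x = radial p (p / 2) s" "F1 ?x = radial p p s"
        using sa by (simp_all add: W_def F1_def sx)
      moreover note \<open>(- 1 / D) * (F1 ?x - W ?x + K) \<le> exit_prob (kill \<alpha>) ?L ?x\<close>
      ultimately show ?thesis by (simp only:)
    qed
    have "exit_prob (kill \<alpha>) ?L ?y \<le> (1 / \<Phi>) * ((F ?y + F1 ?y + W ?y + K) + \<epsilon> * (F ?y + F1 ?y + K))"
    proof (rule exit_prob_le[OF kill_range fin kill_pos _ _ mem(2)])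
      show "?Q (\<lambda>z. (1 / \<Phi>) * ((F z + F1 z + W z + K) + \<epsilon> * (F z + F1 z + K))) z
          \<le> (1 / \<Phi>) * ((F z + F1 z + W z + K) + \<epsilon> * (F z + F1 z + K))" for z
        unfolding krw_avg_cmult krw_avg_add[of _ "\<lambda>z. F z + F1 z + W z + K"]
        using Q1[of z] Q2[of z] \<epsilon>0 \<Phi> by (intro mult_left_mono add_mono) auto
      fix z y assume "z \<in> ?L" "adj z y" and y: "y \<notin> ?L"
      have "\<Phi> \<le> F y + F1 y + W y + \<epsilon> * (F y + F1 y)"
        using upper_barrier_off_lopsided_disc[OF p R y] unfolding W_def F_def F1_def \<epsilon>_def \<Phi>_def .
      also have "\<dots> \<le> (F y + F1 y + W y + K) + \<epsilon> * (F y + F1 y + K)"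
        using mult_left_mono[of "F y + F1 y" "F y + F1 y + K" \<epsilon>] \<epsilon>0 K by linarith
      finally show "1 \<le> (1 / \<Phi>) * ((F y + F1 y + W y + K) + \<epsilon> * (F y + F1 y + K))"
        using \<Phi> by (simp add: field_simps)
    qed
    also have "\<dots> \<le> (1 / \<Phi>) * (radial p p s + K + 1)"
    proof -
      \<comment> \<open>On the negative axis the two leading profiles cancel, leaving only the
        correction and constants.\<close>
      have "F ?y + W ?y = 0" using sa by (simp add: F_def W_def sx)
      then have "F ?y + F1 ?y + W ?y + K = radial p p s + K" by (simp add: F1_def sx)
      then show ?thesis using \<epsilon> \<Phi> by (intro mult_left_mono) auto
    qed
    finally have "2 * exit_prob (kill \<alpha>) ?L ?y \<le> 2 * ((1 / \<Phi>) * (radial p p s + K + 1))" by linarith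
    also have "\<dots> = 2 * (B * (radial p p s + K + 1)) / D" unfolding D_def using B by simp
    also have "\<dots> \<le> (radial p (p / 2) s - radial p p s - K) / D"
      using gap D by (intro divide_right_mono) auto
    finally show ?case using lower by linarith
  qed
  then show thesis using that a1 by blast
qed

theorem theorem1p15:
  fixes \<alpha> :: real
  assumes "14 / 9 < \<alpha>" and "\<alpha> < 2"
  shows "\<not> conditioned_krw_well_defined (kill \<alpha>) \<and>
    (\<exists>(\<Lambda>1 :: nat \<Rightarrow> (int \<times> int) set) (\<Lambda>2 :: nat \<Rightarrow> (int \<times> int) set) (x :: int \<times> int) (y :: int \<times> int).
       exhaustion \<Lambda>1 \<and> exhaustion \<Lambda>2 \<and>
       (\<forall>R. exit_prob (kill \<alpha>) (\<Lambda>1 R) y > 0) \<and>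
       (\<forall>R. exit_prob (kill \<alpha>) (\<Lambda>2 R) y > 0) \<and>
       (let r1 = (\<lambda>R. exit_prob (kill \<alpha>) (\<Lambda>1 R) x / exit_prob (kill \<alpha>) (\<Lambda>1 R) y);
            r2 = (\<lambda>R. exit_prob (kill \<alpha>) (\<Lambda>2 R) x / exit_prob (kill \<alpha>) (\<Lambda>2 R) y)
        in \<not> convergent r1 \<or> \<not> convergent r2 \<or> lim r1 \<noteq> lim r2))"
proof -
  define p where "p = 1 / 2 - \<alpha> / 4"
  have p: "0 < p" "p \<le> 1 / 6" and \<alpha>: "\<alpha> = 2 - 4 * p" "0 < \<alpha>"
    using assms unfolding p_def by auto
  obtain a :: nat where a: "1 < a"
    and ge: "\<forall>\<^sub>F R in sequentially. 2 * exit_prob (kill \<alpha>) (lopsided_disc R) (- int a, 0)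
       \<le> exit_prob (kill \<alpha>) (lopsided_disc R) (int a, 0)"
    by (rule exit_ratio_lopsided_disc_ge_2[OF p \<alpha>(1)])
  let ?x = "(int a, 0) :: site" and ?y = "(- int a, 0) :: site"
  let ?r = "\<lambda>\<Lambda> R. exit_prob (kill \<alpha>) (\<Lambda> R) ?x / exit_prob (kill \<alpha>) (\<Lambda> R) ?y"
  have esc: "?y \<in> escape_set (kill \<alpha>)"
    using a by (intro mem_escape_set_kill[OF \<alpha>(2)]) (simp add: one_less_power)
  have pos: "0 < exit_prob (kill \<alpha>) (\<Lambda> R) ?y" if "exhaustion \<Lambda>" for \<Lambda> R
    using that by (intro exit_prob_pos[OF kill_range _ esc]) (auto simp: exhaustion_def)
  note pos1 = pos[OF exhaustion_disc] and pos2 = pos[OF exhaustion_lopsided_disc]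
  have "?r disc = (\<lambda>R. 1)"
    using exit_prob_disc_reflect pos1 by (auto simp: fun_eq_iff less_imp_neq[THEN not_sym])
  then have lim1: "?r disc \<longlonglongrightarrow> 1" by simp
  have r2: "\<forall>\<^sub>F R in sequentially. 2 \<le> ?r lopsided_disc R"
    using ge by eventually_elim (use pos2 in \<open>simp add: pos_le_divide_eq\<close>)
  have lim2: "2 \<le> l" if "?r lopsided_disc \<longlonglongrightarrow> l" for l
    using tendsto_lowerbound[OF that r2] by simp
  have "\<not> conditioned_krw_well_defined (kill \<alpha>)"
  proof
    assume "conditioned_krw_well_defined (kill \<alpha>)"
    then obtain l where l: "exit_ratio_limit (kill \<alpha>) ?y ?x l"
      using exit_ratio_limit_axis[OF _ \<alpha>(2) a] by blast
    have "?r disc \<longlonglongrightarrow> l" "?r lopsided_disc \<longlonglongrightarrow> l"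
      using l exhaustion_disc exhaustion_lopsided_disc unfolding exit_ratio_limit_def by blast+
    then show False using LIMSEQ_unique[OF lim1] lim2 by fastforce
  qed
  \<comment> \<open>If the lopsided ratios diverge, their \<open>lim\<close> is unspecified but the
    first disjunct holds; if they converge, the limit is at least 2, whereas the discs give
    1.\<close>
  moreover have "\<not> convergent (?r lopsided_disc) \<or> lim (?r disc) \<noteq> lim (?r lopsided_disc)"
  proof (rule disjCI, simp only: not_not)
    assume eq: "lim (?r disc) = lim (?r lopsided_disc)"
    show "\<not> convergent (?r lopsided_disc)"
    proof
      assume "convergent (?r lopsided_disc)"
      then have "2 \<le> lim (?r lopsided_disc)"
        by (intro lim2) (simp add: convergent_LIMSEQ_iff)
      then show False using eq limI[OF lim1] by simp
    qed
  qed
  ultimately show ?thesis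
    using exhaustion_disc exhaustion_lopsided_disc pos1 pos2 unfolding Let_def by blast
qed


end
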